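(* Let $\mu>0$ and let $\Omega$ be a centrally symmetric optimal domain. Then $\partial\Omega$ contains either no line segment or exactly two line segments (maximal segments of positive length).
   Context: Let $\mathcal{C}$ be the class of bounded open convex sets $\Omega\subset\mathbb{R}^2$ whose boundary, of length $P$, is parametrized by arc length with tangent angle $\theta\in W^{1,2}(0,P)$, $\theta'\ge0$ a.e., $\theta(P)=\theta(0)+2\pi$, $\int_0^P\cos\theta=\int_0^P\sin\theta=0$. Curvature $k=\theta'$, $E(\Omega)=\frac12\int_0^Pk^2ds$, $A$ area, $P$ perimeter, $J_\mu=E+\mu A$. An optimal domain is $\Omega\in\mathcal{C}$ with $P(\Omega)=2\pi$ minimizing $J_\mu$ among sets of $\mathcal{C}$ of perimeter $2\pi$. *)

theory Defs
  imports "HOL-Analysis.Analysis"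
begin

text \<open>The plane is modelled as the complex numbers. A triple (L, theta, k) is an
arc-length description of the boundary of Omega: L is the perimeter, theta the tangent
angle (in W^{1,2}(0,L), written as theta(s) = theta(0) + int_0^s k with k in L^2),
k = theta' the curvature, which is nonnegative a.e.\<close>

definition boundary_curve :: "complex \<Rightarrow> (real \<Rightarrow> real) \<Rightarrow> real \<Rightarrow> complex" where
  "boundary_curve x0 \<theta> s = x0 + (\<integral>t\<in>{0..s}. cis (\<theta> t) \<partial>lborel)"

definition classC_rep :: "complex set \<Rightarrow> real \<Rightarrow> (real \<Rightarrow> real) \<Rightarrow> (real \<Rightarrow> real) \<Rightarrow> bool" where
  "classC_rep \<Omega> L \<theta> k \<longleftrightarrow>
     bounded \<Omega> \<and> open \<Omega> \<and> convex \<Omega> \<and>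
     L > 0 \<and>
     set_integrable lborel {0..L} k \<and>
     set_integrable lborel {0..L} (\<lambda>s. (k s)\<^sup>2) \<and>
     (AE s in lborel. s \<in> {0..L} \<longrightarrow> k s \<ge> 0) \<and>
     (\<forall>s\<in>{0..L}. \<theta> s = \<theta> 0 + (\<integral>t\<in>{0..s}. k t \<partial>lborel)) \<and>
     \<theta> L = \<theta> 0 + 2 * pi \<and>
     (\<integral>s\<in>{0..L}. cos (\<theta> s) \<partial>lborel) = 0 \<and>
     (\<integral>s\<in>{0..L}. sin (\<theta> s) \<partial>lborel) = 0 \<and>
     (\<exists>x0. \<Omega> = interior (convex hull (boundary_curve x0 \<theta> ` {0..L})))"

definition elastic_energy :: "real \<Rightarrow> (real \<Rightarrow> real) \<Rightarrow> real" where
  "elastic_energy L k = (1/2) * (\<integral>s\<in>{0..L}. (k s)\<^sup>2 \<partial>lborel)"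

definition J_fun :: "real \<Rightarrow> complex set \<Rightarrow> real \<Rightarrow> (real \<Rightarrow> real) \<Rightarrow> real" where
  "J_fun \<mu> \<Omega> L k = elastic_energy L k + \<mu> * measure lborel \<Omega>"

definition optimal_domain :: "real \<Rightarrow> complex set \<Rightarrow> bool" where
  "optimal_domain \<mu> \<Omega> \<longleftrightarrow>
     (\<exists>\<theta> k. classC_rep \<Omega> (2*pi) \<theta> k \<and>
        (\<forall>\<Omega>' \<theta>' k'. classC_rep \<Omega>' (2*pi) \<theta>' k' \<longrightarrow>
            J_fun \<mu> \<Omega> (2*pi) k \<le> J_fun \<mu> \<Omega>' (2*pi) k'))"

definition centrally_symmetric :: "complex set \<Rightarrow> bool" where
  "centrally_symmetric \<Omega> \<longleftrightarrow> (\<exists>c. \<forall>x. x \<in> \<Omega> \<longleftrightarrow> 2 * c - x \<in> \<Omega>)"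

definition maximal_boundary_segments :: "complex set \<Rightarrow> complex set set" where
  "maximal_boundary_segments \<Omega> =
     {S. \<exists>a b. a \<noteq> b \<and> S = closed_segment a b \<and> S \<subseteq> frontier \<Omega> \<and>
          (\<forall>c d. S \<subseteq> closed_segment c d \<and> closed_segment c d \<subseteq> frontier \<Omega>
                 \<longrightarrow> closed_segment c d = S)}"

end

theory Submission
  imports Defs
begin

text \<open>By central symmetry, two non-parallel boundary segments come with their two opposite segments.
  Lengthening one opposite pair by \<open>e\<close> and shortening the other pair by \<open>e\<close> keeps the curve closed
  and convex and changes neither the perimeter nor the bending energy. In the parallelogram with
  sides in the two directions that circumscribes the domain, the four corners cut off by the domain
  are only translated, so the area changes as the area of the parallelogram, a strictly concave
  function of \<open>e\<close>. Hence one of the values \<open>e = d\<close>, \<open>e = - d\<close> strictly decreases the area, and an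
  optimal domain has at most one pair of boundary segments.\<close>

section \<open>Maximizers of linear functionals on a closed convex curve\<close>

text \<open>A domain of the class is given only as the interior of the convex hull of its curve, so
  no formula expresses its area through the angle. All information therefore passes through the
  support function of the hull: where \<open>v \<bullet> \<gamma>\<close> is maximal, the tangent
  angle is the angle of v plus a quarter turn, so v tells on which arc a maximizer lies. The
  exchange of lengths is carried out on the angle: its graph is moved by e between the middle of one
  flat piece and the middle of the next. On each arc between consecutive flats the new curve is a
  translate of the old one, hence on each quadrant of directions the support function changes by a
  linear functional. The step d is a common half-width of intervals of constant angle, so moves of
  size at most d stay inside the flats. Two obstacles shape the statements. The starting parameter
  may lie inside a side, which then splits between both ends of \<open>{0..L}\<close>. And the
  curvature is nonnegative, and zero on sides, only almost everywhere, so it is replaced by a better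
  representative with the same integrals and energy.\<close>

locale convex_closed_curve =
  fixes L :: real and \<theta> :: "real \<Rightarrow> real" and \<gamma> :: "real \<Rightarrow> complex"
  assumes L_pos: "L > 0"
    and angle_cont: "continuous_on {0..L} \<theta>"
    and angle_mono: "\<And>s t. 0 \<le> s \<Longrightarrow> s \<le> t \<Longrightarrow> t \<le> L \<Longrightarrow> \<theta> s \<le> \<theta> t"
    and angle_total: "\<theta> L = \<theta> 0 + 2 * pi"
    and curve_deriv: "\<And>s. s \<in> {0..L} \<Longrightarrow> (\<gamma> has_vector_derivative cis (\<theta> s)) (at s within {0..L})"
    and curve_closed: "\<gamma> L = \<gamma> 0"
begin

lemma cis_angle_end: "cis (\<theta> L) = cis (\<theta> 0)"
  by (simp add: angle_total cis.ctr)

lemma curve_cont: "continuous_on {0..L} \<gamma>"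
  by (meson continuous_on_vector_derivative curve_deriv)

lemma compact_curve: "compact (\<gamma> ` {0..L})"
  by (intro compact_continuous_image curve_cont) auto

lemma inner_deriv:
  assumes "s \<in> {0..L}"
  shows "((\<lambda>s. v \<bullet> \<gamma> s) has_real_derivative v \<bullet> cis (\<theta> s)) (at s within {0..L})"
  using bounded_linear.has_vector_derivative[OF bounded_linear_inner_right[of v] curve_deriv[OF assms]]
  by (simp add: has_real_derivative_iff_has_vector_derivative)

lemma inner_mvt:
  assumes "0 \<le> s" "s < t" "t \<le> L"
  obtains r where "s < r" "r < t" "v \<bullet> \<gamma> t - v \<bullet> \<gamma> s = (t - s) * (v \<bullet> cis (\<theta> r))"
proof -
  have "\<exists>r\<in>{s<..<t}. v \<bullet> \<gamma> t - v \<bullet> \<gamma> s = (v \<bullet> cis (\<theta> r)) * (t - s)"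
  proof (rule mvt_simple[where f' = "\<lambda>r x. (v \<bullet> cis (\<theta> r)) * x"])
    fix r assume "s \<le> r" "r \<le> t"
    then have "((\<lambda>s. v \<bullet> \<gamma> s) has_real_derivative v \<bullet> cis (\<theta> r)) (at r within {s..t})"
      using assms by (intro DERIV_subset[OF inner_deriv]) auto
    then show "((\<lambda>s. v \<bullet> \<gamma> s) has_derivative (*) (v \<bullet> cis (\<theta> r))) (at r within {s..t})"
      by (simp add: has_field_derivative_def)
  qed (use assms in auto)
  then show thesis using that by (auto simp: mult.commute)
qed

lemma inner_constI:
  assumes "0 \<le> s" "s \<le> t" "t \<le> L" "\<theta> s = \<theta> t" "v \<bullet> cis (\<theta> s) = 0"
  shows "v \<bullet> \<gamma> t = v \<bullet> \<gamma> s"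
proof (cases "s = t")
  case False
  with assms obtain r where r: "s < r" "r < t" "v \<bullet> \<gamma> t - v \<bullet> \<gamma> s = (t - s) * (v \<bullet> cis (\<theta> r))"
    using inner_mvt[of s t v] by auto
  have "\<theta> r = \<theta> s"
    using angle_mono[of s r] angle_mono[of r t] r assms by force
  then show ?thesis using r assms by simp
qed simp

text \<open>Inside the interval this is Fermat's rule. At 0 and at L only one one-sided inequality
  is available, but the curve closes up, so both ends are maximizers, and equal tangents there join
  the two inequalities.\<close>

lemma maximizer_orthogonal:
  assumes s: "s \<in> {0..L}" and max: "\<And>t. t \<in> {0..L} \<Longrightarrow> v \<bullet> \<gamma> t \<le> v \<bullet> \<gamma> s"
  shows "v \<bullet> cis (\<theta> s) = 0"
proof -
  have right: "v \<bullet> cis (\<theta> s) \<le> 0" if "0 \<le> s" "s < L" "\<And>t. t \<in> {0..L} \<Longrightarrow> v \<bullet> \<gamma> t \<le> v \<bullet> \<gamma> s" for s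
  proof (rule ccontr)
    assume "\<not> ?thesis"
    then have "0 < v \<bullet> cis (\<theta> s)" by simp
    moreover have "s \<in> {0..L}" using that by auto
    ultimately obtain d where d: "d > 0" "\<forall>h>0. s + h \<in> {0..L} \<longrightarrow> h < d \<longrightarrow> v \<bullet> \<gamma> s < v \<bullet> \<gamma> (s + h)"
      using has_real_derivative_pos_inc_right[OF inner_deriv] by blast
    define h where "h = min (d/2) (L - s)"
    have "h > 0" "h < d" "s + h \<in> {0..L}" using d that by (auto simp: h_def)
    then show False using d that(3)[of "s+h"] by force
  qed
  have left: "v \<bullet> cis (\<theta> s) \<ge> 0" if "0 < s" "s \<le> L" "\<And>t. t \<in> {0..L} \<Longrightarrow> v \<bullet> \<gamma> t \<le> v \<bullet> \<gamma> s" for s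
  proof (rule ccontr)
    assume "\<not> ?thesis"
    then have "v \<bullet> cis (\<theta> s) < 0" by simp
    moreover have "s \<in> {0..L}" using that by auto
    ultimately obtain d where d: "d > 0" "\<forall>h>0. s - h \<in> {0..L} \<longrightarrow> h < d \<longrightarrow> v \<bullet> \<gamma> s < v \<bullet> \<gamma> (s - h)"
      using has_real_derivative_neg_dec_left[OF inner_deriv] by blast
    define h where "h = min (d/2) s"
    have "h > 0" "h < d" "s - h \<in> {0..L}" using d that by (auto simp: h_def)
    then show False using d that(3)[of "s-h"] by force
  qed
  consider "s = 0" | "s = L" | "0 < s" "s < L" using s by fastforce
  then show ?thesis
  proof cases
    case 1
    have "v \<bullet> cis (\<theta> 0) \<le> 0" using right[of 0] max L_pos 1 by blast
    moreover have "v \<bullet> cis (\<theta> L) \<ge> 0" using left[of L] max L_pos 1 curve_closed by simp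
    ultimately show ?thesis using 1 cis_angle_end by simp
  next
    case 2
    have "v \<bullet> cis (\<theta> 0) \<le> 0" using right[of 0] max L_pos 2 curve_closed by simp
    moreover have "v \<bullet> cis (\<theta> L) \<ge> 0" using left[of L] max L_pos 2 by blast
    ultimately show ?thesis using 2 cis_angle_end by simp
  next
    case 3
    then show ?thesis using right[of s] left[of s] max by (intro antisym) auto
  qed
qed

text \<open>Excludes the inner normal. If v were the tangent turned by +pi/2, the functional would
  not decrease while the angle grows by at most pi/2; a later parameter with strictly larger angle
  would then also be a maximizer, but its tangent is not orthogonal to v.\<close>

lemma maximizer_sign:
  assumes s: "s \<in> {0..L}" and max: "\<And>t. t \<in> {0..L} \<Longrightarrow> v \<bullet> \<gamma> t \<le> v \<bullet> \<gamma> s"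
    and less: "\<theta> s < \<theta> L" and r: "r > 0"
  shows "v \<noteq> rcis r (\<theta> s + pi/2)"
proof
  assume v: "v = rcis r (\<theta> s + pi/2)"
  have in_v: "v \<bullet> cis x = r * sin (x - \<theta> s)" for x
    by (simp add: v inner_complex_def rcis_def sin_diff cos_add sin_add algebra_simps)
  \<comment> \<open>The cap at a quarter turn keeps the sine nonnegative on the way and strictly
    positive at y.\<close>
  define y where "y = min (\<theta> s + pi/2) (\<theta> L)"
  have y: "\<theta> s < y" "y \<le> \<theta> s + pi/2" "y \<le> \<theta> L" using less by (auto simp: y_def)
  obtain t where t: "s \<le> t" "t \<le> L" "\<theta> t = y"
    using IVT'[of \<theta> s y L] y s continuous_on_subset[OF angle_cont, of "{s..L}"] by auto
  have "s \<noteq> t" using t y by auto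
  then obtain q where q: "s < q" "q < t" "v \<bullet> \<gamma> t - v \<bullet> \<gamma> s = (t - s) * (v \<bullet> cis (\<theta> q))"
    using inner_mvt[of s t v] t s by auto
  have "\<theta> s \<le> \<theta> q" "\<theta> q \<le> \<theta> s + pi/2"
    using angle_mono[of s q] angle_mono[of q t] q t s y by auto
  then have "v \<bullet> cis (\<theta> q) \<ge> 0"
    using r by (simp add: in_v sin_ge_zero)
  then have "v \<bullet> \<gamma> s \<le> v \<bullet> \<gamma> t" using q by (metis diff_ge_0_iff_ge less_imp_le mult_nonneg_nonneg order_less_trans)
  then have "v \<bullet> cis (\<theta> t) = 0"
    using max t s by (intro maximizer_orthogonal) (auto intro: order_trans)
  moreover have "sin (y - \<theta> s) > 0" using y pi_gt_zero by (intro sin_gt_zero) linarith+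
  ultimately show False using r by (simp add: in_v t)
qed

text \<open>The inverse Gauss map: orthogonality leaves the outer and the inner normal, and
  \<open>maximizer_sign\<close> rules out the inner one.\<close>

lemma maximizer_angle:
  assumes s: "s \<in> {0..L}" and max: "\<And>t. t \<in> {0..L} \<Longrightarrow> v \<bullet> \<gamma> t \<le> v \<bullet> \<gamma> s"
  shows "rcis (norm v) (\<theta> s - pi/2) = v"
proof (cases "v = 0")
  case False
  have o: "v \<bullet> cis (\<theta> s) = 0" by (rule maximizer_orthogonal) fact+
  obtain a where a: "v = rcis (norm v) a" by (metis rcis_cmod_Arg)
  have "cos (a - \<theta> s) = 0"
    using o False by (subst (asm) a) (simp add: inner_complex_def rcis_def cos_diff distrib_left[symmetric] mult.assoc)
  then have "sin (a - \<theta> s) = 1 \<or> sin (a - \<theta> s) = -1"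
    using sin_cos_squared_add[of "a - \<theta> s"] by (simp add: power2_eq_1_iff)
  then show ?thesis
  proof
    assume 1: "sin (a - \<theta> s) = -1"
    have "cis (a - \<theta> s) = cis (-pi/2)"
      using 1 \<open>cos (a - \<theta> s) = 0\<close> by (simp add: complex_eq_iff)
    then have "cis a = cis (\<theta> s - pi/2)"
      by (metis add.commute cis_mult diff_add_cancel minus_divide_left uminus_add_conv_diff)
    then show ?thesis using a by (simp add: rcis_def)
  next
    assume 1: "sin (a - \<theta> s) = 1"
    have "cis (a - \<theta> s) = cis (pi/2)"
      using 1 \<open>cos (a - \<theta> s) = 0\<close> by (simp add: complex_eq_iff)
    then have "cis a = cis (\<theta> s + pi/2)"
      by (metis add.commute cis_mult diff_add_cancel)
    then have v: "v = rcis (norm v) (\<theta> s + pi/2)" by (subst a) (simp add: rcis_def)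
    show ?thesis
    proof (cases "\<theta> s < \<theta> L")
      case True
      then show ?thesis using maximizer_sign[OF s max] v False by (metis zero_less_norm_iff)
    next
      \<comment> \<open>No turning is left after s. The functional is constant from s to L, and L is
        the same point as 0, where the full turn still lies ahead.\<close>
      case nl: False
      then have e: "\<theta> s = \<theta> L" using angle_mono[of s L] s by auto
      then have "v \<bullet> \<gamma> L = v \<bullet> \<gamma> s" using s o by (intro inner_constI) auto
      then have "\<And>t. t \<in> {0..L} \<Longrightarrow> v \<bullet> \<gamma> t \<le> v \<bullet> \<gamma> 0" using max curve_closed by simp
      moreover have "v = rcis (norm v) (\<theta> 0 + pi/2)"
        using v cis_angle_end unfolding e rcis_def by (simp add: cis_mult[symmetric])
      ultimately show ?thesis using maximizer_sign[of 0 v "norm v"] L_pos False angle_total by simp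
    qed
  qed
qed simp

text \<open>If s lies outside the arc, monotonicity forces the angle to be constant between s and
  the nearer end of the arc, and there the functional does not change.\<close>

lemma maximizer_in_arc:
  assumes s: "s \<in> {0..L}" and max: "\<And>t. t \<in> {0..L} \<Longrightarrow> v \<bullet> \<gamma> t \<le> v \<bullet> \<gamma> s"
    and pq: "0 \<le> p" "p \<le> q" "q \<le> L" and ang: "\<theta> p \<le> \<theta> s" "\<theta> s \<le> \<theta> q"
  obtains t where "t \<in> {p..q}" "v \<bullet> \<gamma> t = v \<bullet> \<gamma> s"
proof -
  have o: "v \<bullet> cis (\<theta> s) = 0" by (rule maximizer_orthogonal) fact+
  consider "s < p" | "s \<in> {p..q}" | "s > q" by force
  then show thesis
  proof cases
    case 1
    then have "\<theta> s = \<theta> p" using angle_mono[of s p] s pq ang by auto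
    then have "v \<bullet> \<gamma> p = v \<bullet> \<gamma> s" using 1 s pq o by (intro inner_constI) auto
    then show thesis using that[of p] pq by auto
  next
    case 2 then show thesis using that by auto
  next
    case 3
    then have "\<theta> s = \<theta> q" using angle_mono[of q s] s pq ang by auto
    then have "v \<bullet> \<gamma> q = v \<bullet> \<gamma> s" using inner_constI[of q s v] 3 s pq o by auto
    then show thesis using that[of q] pq by auto
  qed
qed

text \<open>The two angles belong to the same outer normal, so they agree modulo a full turn. If
  they are equal, the angle is constant in between; otherwise they are the extreme values
  \<open>\<theta> 0\<close> and \<open>\<theta> L\<close>, and the side passes through the starting
  point.\<close>

lemma flat_interval_of_two_maximizers:
  assumes v: "v \<noteq> 0"
    and s: "s \<in> {0..L}" "\<And>r. r \<in> {0..L} \<Longrightarrow> v \<bullet> \<gamma> r \<le> v \<bullet> \<gamma> s"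
    and t: "t \<in> {0..L}" "\<And>r. r \<in> {0..L} \<Longrightarrow> v \<bullet> \<gamma> r \<le> v \<bullet> \<gamma> t"
    and ne: "\<gamma> s \<noteq> \<gamma> t"
  obtains a b \<phi> where "0 \<le> a" "a < b" "b \<le> L" "\<And>r. r \<in> {a..b} \<Longrightarrow> \<theta> r = \<phi>" "rcis (norm v) (\<phi> - pi/2) = v"
proof -
  note found = that
  have *: thesis if st: "s < t" "s \<in> {0..L}" "t \<in> {0..L}" "\<gamma> s \<noteq> \<gamma> t"
    and vs: "rcis (norm v) (\<theta> s - pi/2) = v" and vt: "rcis (norm v) (\<theta> t - pi/2) = v" for s t
  proof (cases "\<theta> s = \<theta> t")
    case True
    then have flat: "\<theta> r = \<theta> s" if "r \<in> {s..t}" for r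
      using angle_mono[of s r] angle_mono[of r t] st that by force
    show thesis by (rule found[OF _ _ _ flat vs]) (use st in auto)
  next
    case False
    have le: "\<theta> 0 \<le> \<theta> s" "\<theta> s \<le> \<theta> t" "\<theta> t \<le> \<theta> L"
      using angle_mono[of 0 s] angle_mono[of s t] angle_mono[of t L] st by auto
    have "cis (\<theta> s - pi/2) = cis (\<theta> t - pi/2)"
      using vs vt v by (metis mult_cancel_left norm_eq_zero of_real_eq_0_iff rcis_def)
    then have "cis (\<theta> s) = cis (\<theta> t)"
      by (metis cis_mult diff_add_cancel)
    then have "cis (\<theta> t - \<theta> s) = 1" by (metis cis_divide cis_neq_zero divide_self)
    then have "cos (\<theta> t - \<theta> s) = 1" by (simp add: complex_eq_iff)
    then obtain n::int where "\<theta> t - \<theta> s = of_int n * 2 * pi" using cos_one_2pi_int by auto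
    moreover have "0 < \<theta> t - \<theta> s" "\<theta> t - \<theta> s \<le> 2 * pi" using le False angle_total by auto
    ultimately have "0 < of_int n * (2 * pi)" "of_int n * (2 * pi) \<le> 1 * (2 * pi)" by auto
    then have "0 < n" "n \<le> 1"
      using pi_gt_zero by (auto simp: zero_less_mult_iff simp del: mult_1)
    then have "n = 1" by simp
    then have e: "\<theta> s = \<theta> 0" "\<theta> t = \<theta> L" using \<open>\<theta> t - \<theta> s = of_int n * 2 * pi\<close> le angle_total by auto
    show thesis
    \<comment> \<open>Of the pieces \<open>{0..s}\<close> and \<open>{t..L}\<close>, both flat, at
      least one is nondegenerate, since s = 0 and t = L would give the same point of the
      curve.\<close>
    proof (cases "0 < s")
      case True
      have flat: "\<theta> r = \<theta> s" if "r \<in> {0..s}" for r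
        using angle_mono[of 0 r] angle_mono[of r s] st that e by force
      show thesis by (rule found[OF _ _ _ flat vs]) (use st True in auto)
    next
      case s0: False
      then have "t \<noteq> L" using st curve_closed by auto
      have flat: "\<theta> r = \<theta> t" if "r \<in> {t..L}" for r
        using angle_mono[of t r] angle_mono[of r L] st that e by force
      show thesis by (rule found[OF _ _ _ flat vt]) (use st \<open>t \<noteq> L\<close> in auto)
    qed
  qed
  have "rcis (norm v) (\<theta> s - pi/2) = v" "rcis (norm v) (\<theta> t - pi/2) = v"
    using maximizer_angle[OF s] maximizer_angle[OF t] by auto
  moreover have "s < t \<or> t < s" using ne by (metis linorder_neqE)
  ultimately show thesis using *[of s t] *[of t s] s t ne by auto
qed

text \<open>The given points need not lie on the curve. A face with two points has two extreme
  points by Krein-Milman, these are extreme in the hull, and extreme points of the hull belong to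
  the curve.\<close>

lemma flat_interval_of_face:
  assumes v: "v \<noteq> 0" and x: "x \<in> convex hull (\<gamma> ` {0..L})" and y: "y \<in> convex hull (\<gamma> ` {0..L})"
    and ne: "x \<noteq> y"
    and xmax: "\<And>z. z \<in> convex hull (\<gamma> ` {0..L}) \<Longrightarrow> v \<bullet> z \<le> v \<bullet> x"
    and ymax: "\<And>z. z \<in> convex hull (\<gamma> ` {0..L}) \<Longrightarrow> v \<bullet> z \<le> v \<bullet> y"
  obtains a b \<phi> where "0 \<le> a" "a < b" "b \<le> L" "\<And>r. r \<in> {a..b} \<Longrightarrow> \<theta> r = \<phi>" "rcis (norm v) (\<phi> - pi/2) = v"
proof -
  let ?K = "convex hull (\<gamma> ` {0..L})"
  define F where "F = ?K \<inter> {z. v \<bullet> z = v \<bullet> x}"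
  have face: "F face_of ?K"
    unfolding F_def by (intro face_of_Int_supporting_hyperplane_le xmax) auto
  have cF: "compact F" "convex F"
    unfolding F_def using compact_convex_hull[OF compact_curve]
    by (auto intro!: compact_Int_closed closed_hyperplane convex_Int convex_hyperplane)
  let ?E = "{z. z extreme_point_of F}"
  have E: "?E \<subseteq> \<gamma> ` {0..L}"
    using extreme_point_of_face[OF face] extreme_point_of_convex_hull by blast
  have "x \<in> F" "y \<in> F" using x y xmax[OF y] ymax[OF x] by (auto simp: F_def)
  then have xy: "x \<in> convex hull ?E" "y \<in> convex hull ?E"
    using Krein_Milman_Minkowski[OF cF] by auto
  have "\<exists>p\<in>?E. \<exists>q\<in>?E. p \<noteq> q"
  proof (rule ccontr)
    assume "\<not> ?thesis"
    then have "?E = {} \<or> (\<exists>p. ?E = {p})" by blast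
    then show False using xy ne by auto
  qed
  then obtain p q where pq: "p \<in> ?E" "q \<in> ?E" "p \<noteq> q" by auto
  then obtain s t where st: "s \<in> {0..L}" "t \<in> {0..L}" "p = \<gamma> s" "q = \<gamma> t" using E by blast
  have "p \<in> F" "q \<in> F" using pq by (auto simp: extreme_point_of_def)
  then have m: "v \<bullet> \<gamma> s = v \<bullet> x" "v \<bullet> \<gamma> t = v \<bullet> x" using st by (auto simp: F_def)
  have "v \<bullet> \<gamma> r \<le> v \<bullet> x" if "r \<in> {0..L}" for r
    using that by (intro xmax hull_inc) auto
  then show thesis
    using flat_interval_of_two_maximizers[OF v, of s t] st pq that m by metis
qed

end

section \<open>Circumscribed parallelograms\<close>

definition support_fn :: "complex set \<Rightarrow> complex \<Rightarrow> real" where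
  "support_fn K v = (SUP x\<in>K. v \<bullet> x)"

lemma support_fn_upper:
  assumes "compact K" "x \<in> K"
  shows "v \<bullet> x \<le> support_fn K v"
proof -
  have "compact ((\<lambda>x. v \<bullet> x) ` K)" using assms by (intro compact_continuous_image continuous_intros)
  then show ?thesis unfolding support_fn_def using assms
    by (intro cSUP_upper bounded_imp_bdd_above compact_imp_bounded)
qed

lemma support_fn_attained:
  assumes "compact K" "K \<noteq> {}"
  obtains x where "x \<in> K" "v \<bullet> x = support_fn K v"
proof -
  have "continuous_on K (\<lambda>x. v \<bullet> x)" by (intro continuous_intros)
  from continuous_attains_sup[OF assms this]
  obtain x where x: "x \<in> K" "\<forall>y\<in>K. v \<bullet> y \<le> v \<bullet> x" by auto
  moreover have "support_fn K v = v \<bullet> x" unfolding support_fn_def using x by (intro cSup_eq_maximum) auto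
  ultimately show thesis using that by simp
qed

lemma support_fn_maximizer:
  assumes "x \<in> K" "\<And>y. y \<in> K \<Longrightarrow> v \<bullet> y \<le> v \<bullet> x"
  shows "support_fn K v = v \<bullet> x"
  unfolding support_fn_def using assms by (intro cSup_eq_maximum) auto

lemma support_fn_convex_hull:
  assumes "x \<in> A" "\<And>y. y \<in> A \<Longrightarrow> v \<bullet> y \<le> v \<bullet> x"
  shows "support_fn (convex hull A) v = v \<bullet> x"
proof (rule support_fn_maximizer)
  show "x \<in> convex hull A" using assms by (simp add: hull_inc)
  have "convex hull A \<subseteq> {y. v \<bullet> y \<le> v \<bullet> x}"
    using assms by (intro hull_minimal convex_halfspace_le) auto
  then show "v \<bullet> y \<le> v \<bullet> x" if "y \<in> convex hull A" for y using that by auto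
qed

text \<open>The part of the wedge \<open>p \<bullet> x \<le> h(p)\<close>, \<open>q \<bullet> x \<le> h(q)\<close> which is cut off from \<open>K\<close> by
  the supporting lines whose outer normals lie between \<open>p\<close> and \<open>q\<close>.\<close>
definition cut_corner :: "complex set \<Rightarrow> complex \<Rightarrow> complex \<Rightarrow> complex set" where
  "cut_corner K p q = {x. p \<bullet> x \<le> support_fn K p \<and> q \<bullet> x \<le> support_fn K q \<and>
     (\<exists>a\<ge>0. \<exists>b\<ge>0. support_fn K (a *\<^sub>R p + b *\<^sub>R q) < (a *\<^sub>R p + b *\<^sub>R q) \<bullet> x)}"

definition bounding_box :: "complex set \<Rightarrow> complex \<Rightarrow> complex \<Rightarrow> complex set" where
  "bounding_box K p q = {x. p \<bullet> x \<le> support_fn K p \<and> -p \<bullet> x \<le> support_fn K (-p)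
      \<and> q \<bullet> x \<le> support_fn K q \<and> -q \<bullet> x \<le> support_fn K (-q)}"

text \<open>A corner depends only on the support function over the cone spanned by p and q, so a
  linear change on this cone is a translation of the corner.\<close>

lemma cut_corner_translate:
  assumes "\<And>a b. a \<ge> 0 \<Longrightarrow> b \<ge> 0 \<Longrightarrow>
     support_fn K' (a *\<^sub>R p + b *\<^sub>R q) = support_fn K (a *\<^sub>R p + b *\<^sub>R q) + (a *\<^sub>R p + b *\<^sub>R q) \<bullet> t"
  shows "cut_corner K' p q = (+) t ` cut_corner K p q"
proof -
  have p: "support_fn K' p = support_fn K p + p \<bullet> t" using assms[of 1 0] by simp
  have q: "support_fn K' q = support_fn K q + q \<bullet> t" using assms[of 0 1] by simp
  have "x \<in> cut_corner K' p q \<longleftrightarrow> x - t \<in> cut_corner K p q" for x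
    using assms by (simp add: cut_corner_def p q inner_diff_right algebra_simps cong: conj_cong)
  then have "cut_corner K' p q = {x. x - t \<in> cut_corner K p q}" by blast
  also have "\<dots> = (+) t ` cut_corner K p q"
  proof
    show "{x. x - t \<in> cut_corner K p q} \<subseteq> (+) t ` cut_corner K p q"
      by (metis (lifting) add_diff_cancel_left' diff_add_cancel add.commute image_eqI mem_Collect_eq subsetI)
  qed auto
  finally show ?thesis .
qed

text \<open>In the violated inequality for \<open>a *\<^sub>R p + b *\<^sub>R q\<close> the q-part
  favours m, so the excess must come from p. This locates a corner relative to the contact points of
  K and separates different corners.\<close>

lemma cut_corner_beyond:
  assumes "x \<in> cut_corner K p q" "compact K" "m \<in> K" "q \<bullet> m = support_fn K q"
  shows "p \<bullet> x > p \<bullet> m"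
proof -
  obtain a b where ab: "a \<ge> 0" "b \<ge> 0" "support_fn K (a *\<^sub>R p + b *\<^sub>R q) < (a *\<^sub>R p + b *\<^sub>R q) \<bullet> x"
    and qx: "q \<bullet> x \<le> support_fn K q"
    using assms by (auto simp: cut_corner_def)
  have "(a *\<^sub>R p + b *\<^sub>R q) \<bullet> m < (a *\<^sub>R p + b *\<^sub>R q) \<bullet> x"
    using support_fn_upper[OF assms(2,3)] ab by (meson le_less_trans)
  then have "a * (p \<bullet> m) + b * (q \<bullet> m) < a * (p \<bullet> x) + b * (q \<bullet> x)" by (simp add: inner_add_left)
  moreover have "b * (q \<bullet> x) \<le> b * (q \<bullet> m)" using ab qx assms(4) by (intro mult_left_mono) auto
  ultimately have "a * (p \<bullet> m) < a * (p \<bullet> x)" by linarith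
  then show ?thesis using ab by (simp add: mult_less_cancel_left)
qed

lemma cut_corner_commute: "cut_corner K p q = cut_corner K q p"
proof -
  have "cut_corner K p q \<subseteq> cut_corner K q p" for p q
  proof
    fix x assume "x \<in> cut_corner K p q"
    then obtain a b where "p \<bullet> x \<le> support_fn K p" "q \<bullet> x \<le> support_fn K q" "a \<ge> 0" "b \<ge> 0"
      "support_fn K (b *\<^sub>R q + a *\<^sub>R p) < (b *\<^sub>R q + a *\<^sub>R p) \<bullet> x"
      unfolding cut_corner_def by (auto simp: add.commute)
    then show "x \<in> cut_corner K q p" unfolding cut_corner_def by blast
  qed
  then show ?thesis by blast
qed

lemma cut_corner_subset_box:
  assumes "compact K" "K \<noteq> {}"
  shows "cut_corner K p q \<subseteq> bounding_box K p q"
proof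
  fix x assume x: "x \<in> cut_corner K p q"
  obtain m where m: "m \<in> K" "q \<bullet> m = support_fn K q" using support_fn_attained[OF assms] by blast
  obtain n where n: "n \<in> K" "p \<bullet> n = support_fn K p" using support_fn_attained[OF assms] by blast
  have "p \<bullet> m < p \<bullet> x" by (rule cut_corner_beyond[OF x assms(1) m])
  moreover have "q \<bullet> n < q \<bullet> x" using x n assms(1) by (intro cut_corner_beyond) (simp_all add: cut_corner_commute)
  ultimately show "x \<in> bounding_box K p q"
    using x support_fn_upper[OF assms(1) m(1), of "-p"] support_fn_upper[OF assms(1) n(1), of "-q"]
    by (auto simp: bounding_box_def cut_corner_def)
qed

lemma cut_corner_disjoint_adjacent:
  assumes "compact K" "K \<noteq> {}"
  shows "cut_corner K p q \<inter> cut_corner K (-p) q = {}"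
proof (rule ccontr)
  assume "\<not> ?thesis"
  then obtain x where x: "x \<in> cut_corner K p q" "x \<in> cut_corner K (-p) q" by auto
  obtain m where m: "m \<in> K" "q \<bullet> m = support_fn K q" using support_fn_attained[OF assms] by blast
  show False
    using cut_corner_beyond[OF x(1) assms(1) m] cut_corner_beyond[OF x(2) assms(1) m] by simp
qed

text \<open>A common point x yields two linear forms with nonnegative coefficients (a, b) and (c,
  d), in the displacements X and Y from a point of K to x, one positive and one negative on K.
  Evaluating both at the contact points m and n, where Y has opposite signs, gives contradictory
  signs of \<open>a * d - b * c\<close>.\<close>

lemma cut_corner_disjoint_opposite:
  assumes "compact K" "K \<noteq> {}"
  shows "cut_corner K p q \<inter> cut_corner K (-p) (-q) = {}"
proof (rule ccontr)
  assume "\<not> ?thesis"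
  then obtain x where x: "x \<in> cut_corner K p q" "x \<in> cut_corner K (-p) (-q)" by auto
  obtain m where m: "m \<in> K" "q \<bullet> m = support_fn K q" using support_fn_attained[OF assms] by blast
  obtain n where n: "n \<in> K" "-q \<bullet> n = support_fn K (-q)" using support_fn_attained[OF assms] by blast
  obtain a b where ab: "a \<ge> 0" "b \<ge> 0" "support_fn K (a *\<^sub>R p + b *\<^sub>R q) < (a *\<^sub>R p + b *\<^sub>R q) \<bullet> x"
    using x by (auto simp: cut_corner_def)
  obtain c d where cd: "c \<ge> 0" "d \<ge> 0" "support_fn K (c *\<^sub>R -p + d *\<^sub>R -q) < (c *\<^sub>R -p + d *\<^sub>R -q) \<bullet> x"
    using x unfolding cut_corner_def by blast
  define X where "X = (\<lambda>y. p \<bullet> x - p \<bullet> y)"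
  define Y where "Y = (\<lambda>y. q \<bullet> x - q \<bullet> y)"
  have pos: "a * X y + b * Y y > 0" if "y \<in> K" for y
    using le_less_trans[OF support_fn_upper[OF assms(1) that] ab(3)]
    by (simp add: inner_add_left X_def Y_def algebra_simps)
  have neg: "c * X y + d * Y y < 0" if "y \<in> K" for y
    using le_less_trans[OF support_fn_upper[OF assms(1) that] cd(3)]
    by (simp add: inner_diff_left X_def Y_def algebra_simps)
  have "X m > 0" "X n < 0"
    using cut_corner_beyond[OF x(1) assms(1) m] cut_corner_beyond[OF x(2) assms(1) n]
    by (auto simp: X_def)
  have "Y m \<le> 0" "Y n \<ge> 0" using x m n by (auto simp: Y_def cut_corner_def)
  \<comment> \<open>The factors c and a eliminate X from the two forms.\<close>
  have "c * (a * X m + b * Y m) \<ge> 0" "c * (a * X n + b * Y n) \<ge> 0"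
    using pos[OF m(1)] pos[OF n(1)] cd by auto
  moreover have "a * (c * X m + d * Y m) \<le> 0" "a * (c * X n + d * Y n) \<le> 0"
    using neg[OF m(1)] neg[OF n(1)] ab by (auto simp: mult_le_0_iff)
  ultimately have *: "(a * d - b * c) * Y m \<le> 0" "(a * d - b * c) * Y n \<le> 0"
    by (auto simp: algebra_simps)
  have a: "a > 0" using pos[OF n(1)] pos[OF m(1)] ab \<open>Y m \<le> 0\<close>
    by (metis add_0 less_le_not_le mult_nonneg_nonpos mult_zero_left order_less_le)
  have c: "c > 0" using neg[OF n(1)] cd \<open>Y n \<ge> 0\<close>
    by (metis add_0 less_le_not_le mult_nonneg_nonneg mult_zero_left order_less_le)
  have "d * Y m < 0" using neg[OF m(1)] c \<open>X m > 0\<close> by (smt (verit) mult_pos_pos)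
  have "b * Y n > 0" using pos[OF n(1)] a \<open>X n < 0\<close> by (smt (verit) mult_pos_neg)
  then have "Y n > 0" "Y m < 0" using \<open>d * Y m < 0\<close> cd ab by (auto simp: zero_less_mult_iff mult_less_0_iff)
  have "c * (a * X m + b * Y m) > 0" using pos[OF m(1)] c by simp
  moreover have "a * (c * X m + d * Y m) < 0" using neg[OF m(1)] a by (simp add: mult_pos_neg)
  ultimately have "(a * d - b * c) * Y m < 0" by (simp add: algebra_simps)
  then have "a * d - b * c > 0" using \<open>Y m < 0\<close> by (simp add: mult_less_0_iff)
  then show False using *(2) \<open>Y n > 0\<close> by (simp add: mult_le_0_iff)
qed

lemma cut_corner_lmeasurable:
  assumes "compact K" "K \<noteq> {}" "bounded (bounding_box K p q)"
  shows "cut_corner K p q \<in> lmeasurable"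
proof (rule bounded_set_imp_lmeasurable)
  show "bounded (cut_corner K p q)"
    by (rule bounded_subset[OF assms(3) cut_corner_subset_box[OF assms(1,2)]])
  \<comment> \<open>The existential condition is an uncountable union of open half-planes, but it is
    open, hence measurable.\<close>
  have "cut_corner K p q = {x. p \<bullet> x \<le> support_fn K p} \<inter> {x. q \<bullet> x \<le> support_fn K q} \<inter>
     (\<Union>a\<in>{0..}. \<Union>b\<in>{0..}. {x. support_fn K (a *\<^sub>R p + b *\<^sub>R q) < (a *\<^sub>R p + b *\<^sub>R q) \<bullet> x})"
    by (auto simp: cut_corner_def)
  moreover have "open (\<Union>a\<in>{0..}. \<Union>b\<in>{0..}. {x. support_fn K (a *\<^sub>R p + b *\<^sub>R q) < (a *\<^sub>R p + b *\<^sub>R q) \<bullet> x})"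
    by (intro open_UN ballI open_halfspace_gt)
  moreover have "closed {x. p \<bullet> x \<le> support_fn K p}" "closed {x. q \<bullet> x \<le> support_fn K q}"
    by (auto intro: closed_halfspace_le)
  ultimately show "cut_corner K p q \<in> sets lebesgue" 
    by (simp add: borel_closed borel_open lborelD sets.Int)
qed

section \<open>Areas of parallelograms and of convex bodies inscribed in them\<close>

definition parallelogram :: "complex \<Rightarrow> complex \<Rightarrow> real \<Rightarrow> real \<Rightarrow> complex set" where
  "parallelogram p q a b = {x. 0 \<le> p \<bullet> x \<and> p \<bullet> x \<le> a \<and> 0 \<le> q \<bullet> x \<and> q \<bullet> x \<le> b}"

text \<open>The vectors u and w are the side directions, and p and q the dual basis: p is normal to
  the sides along w, q to those along u. In these coordinates \<open>parallelogram p q a b\<close>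
  is spanned by \<open>a *\<^sub>R u\<close> and \<open>b *\<^sub>R w\<close>.\<close>

locale dual_frame =
  fixes p q u w :: complex
  assumes dual: "p \<bullet> u = 1" "p \<bullet> w = 0" "q \<bullet> u = 0" "q \<bullet> w = 1"
    and span: "\<And>x. x = (p \<bullet> x) *\<^sub>R u + (q \<bullet> x) *\<^sub>R w"
begin

lemma swap: "dual_frame q p w u"
  using dual span by unfold_locales (simp_all add: add.commute)

lemma span_dual: "v = (v \<bullet> u) *\<^sub>R p + (v \<bullet> w) *\<^sub>R q"
proof (rule vector_eq_ldot[THEN iffD1], rule allI)
  fix x
  have "v \<bullet> x = (p \<bullet> x) * (v \<bullet> u) + (q \<bullet> x) * (v \<bullet> w)"
    by (subst span[of x]) (simp add: inner_add_right)
  then show "x \<bullet> v = x \<bullet> ((v \<bullet> u) *\<^sub>R p + (v \<bullet> w) *\<^sub>R q)"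
    by (simp add: inner_add_right inner_commute mult.commute)
qed

lemma nonzero: "p \<noteq> 0" "q \<noteq> 0"
  using dual by auto

lemma compact_parallelogram: "compact (parallelogram p q a b)"
proof -
  have "closed (parallelogram p q a b)"
    unfolding parallelogram_def by (intro closed_Collect_conj closed_Collect_le continuous_intros)
  moreover have "bounded (parallelogram p q a b)"
  proof (rule boundedI)
    fix x assume x: "x \<in> parallelogram p q a b"
    have "norm x \<le> norm ((p \<bullet> x) *\<^sub>R u) + norm ((q \<bullet> x) *\<^sub>R w)"
      using span[of x] by (metis norm_triangle_ineq)
    also have "\<dots> \<le> a * norm u + b * norm w"
      using x by (auto simp: parallelogram_def intro!: add_mono mult_right_mono)
    finally show "norm x \<le> a * norm u + b * norm w" .
  qed
  ultimately show ?thesis by (simp add: compact_eq_bounded_closed)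
qed

text \<open>Two parallelograms stacked along u overlap only in a line. Additivity in each side
  together with positivity replaces the determinant formula for the area in what follows.\<close>

lemma measure_parallelogram_add:
  assumes "0 \<le> a" "0 \<le> a'"
  shows "measure lebesgue (parallelogram p q (a + a') b) =
    measure lebesgue (parallelogram p q a b) + measure lebesgue (parallelogram p q a' b)"
proof -
  let ?T = "(+) (a *\<^sub>R u) ` parallelogram p q a' b"
  have T: "?T = {x. a \<le> p \<bullet> x \<and> p \<bullet> x \<le> a + a' \<and> 0 \<le> q \<bullet> x \<and> q \<bullet> x \<le> b}"
  proof
    show "{x. a \<le> p \<bullet> x \<and> p \<bullet> x \<le> a + a' \<and> 0 \<le> q \<bullet> x \<and> q \<bullet> x \<le> b} \<subseteq> ?T"
    proof
      fix x assume x: "x \<in> {x. a \<le> p \<bullet> x \<and> p \<bullet> x \<le> a + a' \<and> 0 \<le> q \<bullet> x \<and> q \<bullet> x \<le> b}"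
      then have "x - a *\<^sub>R u \<in> parallelogram p q a' b"
        by (auto simp: parallelogram_def inner_diff_right dual)
      then have "a *\<^sub>R u + (x - a *\<^sub>R u) \<in> ?T" by (rule imageI)
      then show "x \<in> ?T" by simp
    qed
  qed (auto simp: parallelogram_def inner_add_right dual)
  have un: "parallelogram p q (a + a') b = parallelogram p q a b \<union> ?T"
    unfolding T using assms by (auto simp: parallelogram_def)
  have "parallelogram p q a b \<inter> ?T \<subseteq> {x. p \<bullet> x = a}"
    unfolding T by (auto simp: parallelogram_def)
  then have "negligible (parallelogram p q a b \<inter> ?T)"
    using negligible_hyperplane[of p a] nonzero negligible_subset by blast
  then have "measure lebesgue (parallelogram p q a b \<inter> ?T) = 0"
    by (rule negligible_imp_measure0)
  moreover have "parallelogram p q a b \<in> lmeasurable" "?T \<in> lmeasurable"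
    by (auto intro!: lmeasurable_compact compact_parallelogram compact_translation)
  ultimately have "measure lebesgue (parallelogram p q (a + a') b) =
    measure lebesgue (parallelogram p q a b) + measure lebesgue ?T"
    unfolding un by (simp add: measure_Un3)
  then show ?thesis by (simp add: measure_translation)
qed

lemma measure_parallelogram_pos:
  assumes "0 < a" "0 < b"
  shows "0 < measure lebesgue (parallelogram p q a b)"
proof -
  let ?U = "{x. 0 < p \<bullet> x \<and> p \<bullet> x < a \<and> 0 < q \<bullet> x \<and> q \<bullet> x < b}"
  have o: "open ?U" by (intro open_Collect_conj open_Collect_less continuous_intros)
  have "(a/2) *\<^sub>R u + (b/2) *\<^sub>R w \<in> ?U" using assms by (simp add: inner_add_right dual)
  then have "\<not> negligible ?U" using open_not_negligible[OF o] by blast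
  moreover have "?U \<subseteq> parallelogram p q a b" by (auto simp: parallelogram_def)
  ultimately have "\<not> negligible (parallelogram p q a b)" using negligible_subset by blast
  then show ?thesis
    using lmeasurable_compact[OF compact_parallelogram]
    by (metis measure_nonneg negligible_iff_measure order_le_less)
qed

lemma parallelogram_swap: "parallelogram p q a b = parallelogram q p b a"
  by (auto simp: parallelogram_def)

lemma measure_parallelogram_add':
  assumes "0 \<le> b" "0 \<le> b'"
  shows "measure lebesgue (parallelogram p q a (b + b')) =
    measure lebesgue (parallelogram p q a b) + measure lebesgue (parallelogram p q a b')"
  using dual_frame.measure_parallelogram_add[OF swap assms] by (simp add: parallelogram_swap)

text \<open>The analogue of (a + e)(b - e) + (a - e)(b + e) = 2ab - 2e^2: cutting along the sides
  shows that the defect is twice the area of the parallelogram with both sides e.\<close>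

lemma measure_parallelogram_concave:
  assumes "0 \<le> a - e" "0 \<le> b - e" "0 < e"
  shows "measure lebesgue (parallelogram p q (a + e) (b - e)) + measure lebesgue (parallelogram p q (a - e) (b + e))
    < 2 * measure lebesgue (parallelogram p q a b)"
proof -
  let ?m = "\<lambda>a b. measure lebesgue (parallelogram p q a b)"
  have "?m (a + e) (b - e) = ?m a (b - e) + ?m e (b - e)" "?m (a - e) (b + e) = ?m (a - e) b + ?m (a - e) e"
    using assms by (auto simp: measure_parallelogram_add measure_parallelogram_add')
  moreover have "?m a b = ?m a (b - e) + ?m a e" "?m a e = ?m (a - e) e + ?m e e"
     "?m a b = ?m (a - e) b + ?m e b" "?m e b = ?m e (b - e) + ?m e e"
    using assms measure_parallelogram_add[of "a - e" e e] measure_parallelogram_add[of "a - e" e b]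
      measure_parallelogram_add'[of "b - e" e e] measure_parallelogram_add'[of "b - e" e a] by auto
  moreover have "?m e e > 0" using assms by (intro measure_parallelogram_pos)
  ultimately show ?thesis by linarith
qed

lemma bounding_box_eq:
  "bounding_box K p q = (+) (- support_fn K (-p) *\<^sub>R u - support_fn K (-q) *\<^sub>R w) `
     parallelogram p q (support_fn K p + support_fn K (-p)) (support_fn K q + support_fn K (-q))"
  (is "_ = (+) ?t ` ?P")
proof
  show "bounding_box K p q \<subseteq> (+) ?t ` ?P"
  proof
    fix x assume x: "x \<in> bounding_box K p q"
    then have "x - ?t \<in> ?P"
      by (auto simp: parallelogram_def bounding_box_def inner_diff_right inner_add_right dual)
    then have "?t + (x - ?t) \<in> (+) ?t ` ?P" by (rule imageI)
    then show "x \<in> (+) ?t ` ?P" by simp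
  qed
qed (auto simp: parallelogram_def bounding_box_def inner_diff_right inner_add_right dual)

text \<open>K and the four corners partition the box. A box point outside K is separated from K by a
  direction v, and the signs of the coordinates of v with respect to p and q say which corner
  contains the point.\<close>

lemma measure_eq_box_minus_corners:
  assumes K: "compact K" "convex K" "K \<noteq> {}"
  shows "measure lebesgue K = measure lebesgue (parallelogram p q (support_fn K p + support_fn K (-p)) (support_fn K q + support_fn K (-q)))
    - (measure lebesgue (cut_corner K p q) + measure lebesgue (cut_corner K p (-q))
       + measure lebesgue (cut_corner K (-p) q) + measure lebesgue (cut_corner K (-p) (-q)))"
proof -
  have box: "bounding_box K p (-q) = bounding_box K p q" "bounding_box K (-p) q = bounding_box K p q"
    "bounding_box K (-p) (-q) = bounding_box K p q"
    by (auto simp: bounding_box_def)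
  have cb: "compact (bounding_box K p q)"
    unfolding bounding_box_eq by (intro compact_translation compact_parallelogram)
  then have bb: "bounded (bounding_box K p q)" by (rule compact_imp_bounded)
  let ?A = "cut_corner K p q" and ?B = "cut_corner K p (-q)" and ?D = "cut_corner K (-p) q" and ?E = "cut_corner K (-p) (-q)"
  have meas: "?A \<in> lmeasurable" "?B \<in> lmeasurable" "?D \<in> lmeasurable" "?E \<in> lmeasurable" "K \<in> lmeasurable"
    using cut_corner_lmeasurable[OF K(1,3)] lmeasurable_compact[OF K(1)] bb by (simp_all add: box)
  have outside: "K \<inter> cut_corner K p' q' = {}" for p' q'
  proof -
    have "x \<notin> cut_corner K p' q'" if "x \<in> K" for x
      using support_fn_upper[OF K(1) that] unfolding cut_corner_def by (simp add: not_less)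
    then show ?thesis by blast
  qed
  note adj = cut_corner_disjoint_adjacent[OF K(1,3)] and opp = cut_corner_disjoint_opposite[OF K(1,3)]
  have disj: "?A \<inter> ?D = {}" "?B \<inter> ?E = {}" "?A \<inter> ?E = {}" "?B \<inter> ?D = {}" "?A \<inter> ?B = {}" "?D \<inter> ?E = {}"
    using adj[of p q] adj[of p "-q"] opp[of p q] opp[of p "-q"] adj[of q p] adj[of q "-p"]
    by (simp_all add: cut_corner_commute)
  have "bounding_box K p q \<subseteq> K \<union> (?A \<union> (?B \<union> (?D \<union> ?E)))"
  proof
    fix x assume x: "x \<in> bounding_box K p q"
    show "x \<in> K \<union> (?A \<union> (?B \<union> (?D \<union> ?E)))"
    proof (cases "x \<in> K")
      case False
      then obtain v' b where v': "v' \<bullet> x < b" "\<forall>y\<in>K. b < v' \<bullet> y"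
        using separating_hyperplane_closed_point[OF K(2) compact_imp_closed[OF K(1)]] by blast
      define v where "v = - v'"
      obtain y where "y \<in> K" "v \<bullet> y = support_fn K v" using support_fn_attained[OF K(1,3)] by blast
      then have v: "support_fn K v < v \<bullet> x" using v' by (force simp: v_def)
      define a where "a = v \<bullet> u" define c where "c = v \<bullet> w"
      have vv: "v = a *\<^sub>R p + c *\<^sub>R q" unfolding a_def c_def by (rule span_dual)
      have in_corner: "x \<in> cut_corner K p' q'" if "a' \<ge> 0" "b' \<ge> 0" "v = a' *\<^sub>R p' + b' *\<^sub>R q'"
        "p' \<bullet> x \<le> support_fn K p'" "q' \<bullet> x \<le> support_fn K q'" for a' b' p' q'
        unfolding cut_corner_def using that v by blast
      have hx: "p \<bullet> x \<le> support_fn K p" "(-p) \<bullet> x \<le> support_fn K (-p)" "q \<bullet> x \<le> support_fn K q" "(-q) \<bullet> x \<le> support_fn K (-q)"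
        using x by (auto simp: bounding_box_def)
      consider "a \<ge> 0" "c \<ge> 0" | "a \<ge> 0" "-c \<ge> 0" | "-a \<ge> 0" "c \<ge> 0" | "-a \<ge> 0" "-c \<ge> 0" by linarith
      then show ?thesis
      proof cases
        case 1 then show ?thesis using in_corner[of a c p q] hx vv by simp
      next
        case 2 then show ?thesis using in_corner[of a "-c" p "-q"] hx vv by simp
      next
        case 3 then show ?thesis using in_corner[of "-a" c "-p" q] hx vv by simp
      next
        case 4 then show ?thesis using in_corner[of "-a" "-c" "-p" "-q"] hx vv by simp
      qed
    qed simp
  qed
  moreover have "K \<subseteq> bounding_box K p q"
    using support_fn_upper[OF K(1), of _ p] support_fn_upper[OF K(1), of _ "-p"]
      support_fn_upper[OF K(1), of _ q] support_fn_upper[OF K(1), of _ "-q"] by (auto simp: bounding_box_def)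
  moreover have "?A \<subseteq> bounding_box K p q" "?B \<subseteq> bounding_box K p q" "?D \<subseteq> bounding_box K p q" "?E \<subseteq> bounding_box K p q"
    using cut_corner_subset_box[OF K(1,3)] box by metis+
  ultimately have "bounding_box K p q = K \<union> (?A \<union> (?B \<union> (?D \<union> ?E)))" by blast
  moreover have "measure lebesgue (K \<union> (?A \<union> (?B \<union> (?D \<union> ?E)))) =
     measure lebesgue K + (measure lebesgue ?A + (measure lebesgue ?B + (measure lebesgue ?D + measure lebesgue ?E)))"
    using meas outside disj by (simp add: measure_Un3 fmeasurable.Un Int_Un_distrib)
  moreover have "measure lebesgue (bounding_box K p q) = measure lebesgue (parallelogram p q (support_fn K p + support_fn K (-p)) (support_fn K q + support_fn K (-q)))"
    unfolding bounding_box_eq by (rule measure_translation)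
  ultimately show ?thesis by simp
qed

text \<open>How the support function changes when the sides of direction \<open>u\<close> are lengthened by \<open>e\<close> and
  those of direction \<open>w\<close> are shortened by \<open>e\<close>.\<close>
definition side_exchange :: "real \<Rightarrow> complex set \<Rightarrow> complex set \<Rightarrow> bool" where
  "side_exchange e K K' \<longleftrightarrow> (\<forall>v.
      (v \<bullet> u \<ge> 0 \<longrightarrow> v \<bullet> w \<ge> 0 \<longrightarrow> support_fn K' v = support_fn K v + v \<bullet> (e *\<^sub>R (u - w))) \<and>
      (v \<bullet> u \<ge> 0 \<longrightarrow> v \<bullet> w \<le> 0 \<longrightarrow> support_fn K' v = support_fn K v + v \<bullet> (e *\<^sub>R u)) \<and>
      (v \<bullet> u \<le> 0 \<longrightarrow> v \<bullet> w \<ge> 0 \<longrightarrow> support_fn K' v = support_fn K v + v \<bullet> (- e *\<^sub>R w)) \<and>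
      (v \<bullet> u \<le> 0 \<longrightarrow> v \<bullet> w \<le> 0 \<longrightarrow> support_fn K' v = support_fn K v))"

text \<open>Translated corners cancel in the difference of areas. The first two conclusions hold
  because they are widths of the nonempty set \<open>K'\<close>; used for both e and -e they supply
  the side conditions of \<open>measure_parallelogram_concave\<close>.\<close>

lemma side_exchange_measure:
  assumes K: "compact K" "convex K" "K \<noteq> {}" and K': "compact K'" "convex K'" "K' \<noteq> {}"
    and ex: "side_exchange e K K'"
  defines "W \<equiv> support_fn K p + support_fn K (-p)" and "H \<equiv> support_fn K q + support_fn K (-q)"
  shows "W + e \<ge> 0" "H - e \<ge> 0"
    "measure lebesgue K' - measure lebesgue K =
      measure lebesgue (parallelogram p q (W + e) (H - e)) - measure lebesgue (parallelogram p q W H)"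
proof -
  have "support_fn K' p = support_fn K p + e" "support_fn K' (-p) = support_fn K (-p)"
    "support_fn K' q = support_fn K q - e" "support_fn K' (-q) = support_fn K (-q)"
    using ex[unfolded side_exchange_def, rule_format, of p] ex[unfolded side_exchange_def, rule_format, of "-p"]
      ex[unfolded side_exchange_def, rule_format, of q] ex[unfolded side_exchange_def, rule_format, of "-q"]
    by (simp_all add: dual inner_diff_right)
  then have WH: "support_fn K' p + support_fn K' (-p) = W + e" "support_fn K' q + support_fn K' (-q) = H - e"
    by (auto simp: W_def H_def)
  have nonneg: "support_fn K' v + support_fn K' (-v) \<ge> 0" for v
    using K' support_fn_upper[of K' _ v] support_fn_upper[of K' _ "-v"] by fastforce
  show "W + e \<ge> 0" "H - e \<ge> 0" using nonneg[of p] nonneg[of q] WH by auto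
  have "cut_corner K' p q = (+) (e *\<^sub>R (u - w)) ` cut_corner K p q"
    using ex by (intro cut_corner_translate) (simp add: side_exchange_def dual inner_add_left)
  moreover have "cut_corner K' p (-q) = (+) (e *\<^sub>R u) ` cut_corner K p (-q)"
    using ex by (intro cut_corner_translate) (simp add: side_exchange_def dual inner_add_left inner_diff_left)
  moreover have "cut_corner K' (-p) q = (+) (- e *\<^sub>R w) ` cut_corner K (-p) q"
    using ex by (intro cut_corner_translate) (simp add: side_exchange_def dual inner_diff_left)
  moreover have "cut_corner K' (-p) (-q) = (+) 0 ` cut_corner K (-p) (-q)"
    using ex by (intro cut_corner_translate) (simp add: side_exchange_def dual inner_add_left inner_diff_left)
  ultimately show "measure lebesgue K' - measure lebesgue K =
      measure lebesgue (parallelogram p q (W + e) (H - e)) - measure lebesgue (parallelogram p q W H)"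
    unfolding measure_eq_box_minus_corners[OF K] measure_eq_box_minus_corners[OF K'] WH
    unfolding W_def[symmetric] H_def[symmetric] by (simp only: measure_translation)
qed

lemma side_exchange_concave:
  assumes "compact K" "convex K" "K \<noteq> {}" "compact K1" "convex K1" "K1 \<noteq> {}"
    "compact K2" "convex K2" "K2 \<noteq> {}"
    and e: "e > 0" and "side_exchange e K K1" "side_exchange (-e) K K2"
  shows "measure lebesgue K1 + measure lebesgue K2 < 2 * measure lebesgue K"
proof -
  note 1 = side_exchange_measure[of K K1 e, OF assms(1-6) assms(11)]
  note 2 = side_exchange_measure[of K K2 "-e", OF assms(1-3) assms(7-9) assms(12)]
  show ?thesis
    using measure_parallelogram_concave[of "support_fn K p + support_fn K (-p)" e "support_fn K q + support_fn K (-q)"]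
      1 2 e by simp
qed

end

section \<open>Translating a piece of the tangent angle\<close>

lemma set_integrable_Icc_combine:
  fixes f :: "real \<Rightarrow> 'a::{banach, second_countable_topology}"
  assumes "set_integrable lborel {a..b} f" "set_integrable lborel {b..c} f"
  shows "set_integrable lborel {a..c} f"
  by (rule set_integrable_subset[OF set_integrable_Un[OF assms]]) auto

lemma set_integral_Icc_combine:
  fixes f :: "real \<Rightarrow> 'a::{banach, second_countable_topology}"
  assumes "a \<le> b" "b \<le> c" "set_integrable lborel {a..c} f"
  shows "(LINT t:{a..c}|lborel. f t) = (LINT t:{a..b}|lborel. f t) + (LINT t:{b..c}|lborel. f t)"
proof -
  have "{a..c} = {a..b} \<union> {b..c}" using assms by auto
  moreover have "(LINT t:{a..b} \<union> {b..c}|lborel. f t) = (LINT t:{a..b}|lborel. f t) + (LINT t:{b..c}|lborel. f t)"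
  proof (rule set_integral_Un_AE)
    show "AE x in lborel. \<not> (x \<in> {a..b} \<and> x \<in> {b..c})"
      using AE_lborel_singleton[of b] by eventually_elim auto
  qed (use assms in \<open>auto intro: set_integrable_subset[OF assms(3)]\<close>)
  ultimately show ?thesis by simp
qed

lemma set_integrable_Icc_shift:
  fixes f :: "real \<Rightarrow> 'a::{banach, second_countable_topology}"
  assumes "set_integrable lborel {a - e..b - e} f"
  shows "set_integrable lborel {a..b} (\<lambda>t. f (t - e))"
proof -
  have "integrable lborel (\<lambda>x. indicator {a - e..b - e} (- e + 1 * x) *\<^sub>R f (- e + 1 * x))"
    using assms unfolding set_integrable_def by (intro lborel_integrable_real_affine) auto
  moreover have "(\<lambda>x. indicator {a - e..b - e} (- e + 1 * x) *\<^sub>R f (- e + 1 * x)) = (\<lambda>x. indicator {a..b} x *\<^sub>R f (x - e))"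
    by (auto simp: indicator_def fun_eq_iff)
  ultimately show ?thesis unfolding set_integrable_def by simp
qed

lemma set_integral_Icc_shift:
  fixes f :: "real \<Rightarrow> 'a::{banach, second_countable_topology}"
  shows "(LINT t:{a..b}|lborel. f (t - e)) = (LINT t:{a - e..b - e}|lborel. f t)"
proof -
  have "(LINT x|lborel. indicator {a - e..b - e} x *\<^sub>R f x) =
      (LINT x|lborel. indicator {a - e..b - e} (- e + 1 * x) *\<^sub>R f (- e + 1 * x))"
    using lborel_integral_real_affine[of 1 "\<lambda>x. indicator {a - e..b - e} x *\<^sub>R f x" "-e"] by simp
  also have "(\<lambda>x. indicator {a - e..b - e} (- e + 1 * x) *\<^sub>R f (- e + 1 * x)) = (\<lambda>x. indicator {a..b} x *\<^sub>R f (x - e))"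
    by (auto simp: indicator_def fun_eq_iff)
  finally show ?thesis unfolding set_lebesgue_integral_def by simp
qed

lemma set_integral_Icc_cong:
  fixes f :: "real \<Rightarrow> 'a::{banach, second_countable_topology}"
  assumes "\<And>t. t \<in> {a..b} \<Longrightarrow> f t = g t"
  shows "(LINT t:{a..b}|lborel. f t) = (LINT t:{a..b}|lborel. g t)"
  by (rule set_lebesgue_integral_cong) (use assms in auto)

lemma set_integrable_Icc_cong:
  fixes f :: "real \<Rightarrow> 'a::{banach, second_countable_topology}"
  assumes "set_integrable lborel {a..b} f" "\<And>t. t \<in> {a..b} \<Longrightarrow> g t = f t"
  shows "set_integrable lborel {a..b} g"
  using assms(1) set_integrable_cong[of lborel lborel "{a..b}" "{a..b}" g f] assms(2) by blast

lemma set_integral_Icc_flat: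
  fixes f :: "real \<Rightarrow> 'a::{banach, second_countable_topology}"
  assumes f: "set_integrable lborel {0..L} f" and "0 \<le> a" "b \<le> L"
    and flat: "\<And>t. t \<in> {a..b} \<Longrightarrow> f t = c" and x: "x \<in> {a..b}" and y: "y \<in> {a..b}"
  shows "(LINT t:{0..y}|lborel. f t) = (LINT t:{0..x}|lborel. f t) + (y - x) *\<^sub>R c"
proof -
  have *: "(LINT t:{0..y}|lborel. f t) = (LINT t:{0..x}|lborel. f t) + (y - x) *\<^sub>R c"
    if "x \<le> y" "x \<in> {a..b}" "y \<in> {a..b}" for x y
  proof -
    have "(LINT t:{x..y}|lborel. f t) = (LINT t:{x..y}|lborel. c)"
      using flat that by (intro set_integral_Icc_cong) auto
    also have "\<dots> = (y - x) *\<^sub>R c" using that by (simp add: set_integral_const)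
    finally show ?thesis
      using set_integral_Icc_combine[of 0 x y f] that assms set_integrable_subset[OF f, of "{0..y}"] by auto
  qed
  show ?thesis
  proof (cases "x \<le> y")
    case False
    then have "(LINT t:{0..x}|lborel. f t) = (LINT t:{0..y}|lborel. f t) + (x - y) *\<^sub>R c"
      using *[of y x] x y by simp
    then show ?thesis by (simp add: scaleR_diff_left)
  qed (rule *[OF _ x y])
qed

text \<open>For f constant near p and near q this takes the length e from the flat at q and gives it
  to the flat at p; a negative e does the reverse.\<close>

definition shift_on :: "real \<Rightarrow> real \<Rightarrow> real \<Rightarrow> (real \<Rightarrow> 'a) \<Rightarrow> real \<Rightarrow> 'a" where
  "shift_on p q e f s = (if s \<in> {p..q} then f (s - e) else f s)"

locale flat_ends =
  fixes L p q d e :: real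
  assumes ends: "0 \<le> p - d" "p + d \<le> q - d" "q + d \<le> L" and d_pos: "0 < d" and e: "\<bar>e\<bar> \<le> d"
begin

text \<open>The primitive gains e times the value at p when the longer flat is passed and loses e
  times the value at q at the shorter one. The general codomain lets the same statement serve the
  curvature, its square and the tangent vector.\<close>

lemma shift_on_integral:
  fixes f :: "real \<Rightarrow> 'a::{banach, second_countable_topology}"
  assumes f: "set_integrable lborel {0..L} f"
    and fp: "\<And>t. t \<in> {p - d..p + d} \<Longrightarrow> f t = cp" and fq: "\<And>t. t \<in> {q - d..q + d} \<Longrightarrow> f t = cq"
  shows shift_on_integrable: "set_integrable lborel {0..L} (shift_on p q e f)"
    and "s \<in> {0..p} \<Longrightarrow> (LINT t:{0..s}|lborel. shift_on p q e f t) = (LINT t:{0..s}|lborel. f t)"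
    and "s \<in> {p..q} \<Longrightarrow> (LINT t:{0..s}|lborel. shift_on p q e f t) = (LINT t:{0..s - e}|lborel. f t) + e *\<^sub>R cp"
    and "s \<in> {q..L} \<Longrightarrow> (LINT t:{0..s}|lborel. shift_on p q e f t) = (LINT t:{0..s}|lborel. f t) + e *\<^sub>R (cp - cq)"
proof -
  let ?g = "shift_on p q e f"
  have at: "f (p - e) = f p" "f (q - e) = f q" using fp[of p] fp[of "p - e"] fq[of q] fq[of "q - e"] e by (simp_all add: abs_le_iff)
  have fi: "set_integrable lborel {x..y} f" if "0 \<le> x" "y \<le> L" for x y
    by (rule set_integrable_subset[OF f]) (use that in auto)
  have e': "- d \<le> e" "e \<le> d" using e by auto
  have g1: "?g t = f t" if "t \<in> {0..p}" for t using that at by (auto simp: shift_on_def)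
  have g2: "?g t = f (t - e)" if "t \<in> {p..q}" for t using that by (auto simp: shift_on_def)
  have g3: "?g t = f t" if "t \<in> {q..L}" for t using that at by (auto simp: shift_on_def)
  have i1: "set_integrable lborel {0..p} ?g"
    by (rule set_integrable_Icc_cong[OF fi g1]) (use ends e' in auto)
  have i2: "set_integrable lborel {p..q} ?g"
    by (rule set_integrable_Icc_cong[OF set_integrable_Icc_shift[OF fi] g2]) (use ends e' in auto)
  have i3: "set_integrable lborel {q..L} ?g"
    by (rule set_integrable_Icc_cong[OF fi g3]) (use ends e' in auto)
  show int: "set_integrable lborel {0..L} ?g"
    by (rule set_integrable_Icc_combine[OF set_integrable_Icc_combine[OF i1 i2] i3])
  have gi: "set_integrable lborel {x..y} ?g" if "0 \<le> x" "y \<le> L" for x y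
    by (rule set_integrable_subset[OF int]) (use that in auto)
  show I1: "(LINT t:{0..s}|lborel. ?g t) = (LINT t:{0..s}|lborel. f t)" if "s \<in> {0..p}" for s
    using that g1 by (intro set_integral_Icc_cong) auto
  show I2: "(LINT t:{0..s}|lborel. ?g t) = (LINT t:{0..s - e}|lborel. f t) + e *\<^sub>R cp" if s: "s \<in> {p..q}" for s
  proof -
    have "(LINT t:{0..s}|lborel. ?g t) = (LINT t:{0..p}|lborel. ?g t) + (LINT t:{p..s}|lborel. ?g t)"
      using s ends e' by (intro set_integral_Icc_combine) (auto intro: gi)
    also have "(LINT t:{p..s}|lborel. ?g t) = (LINT t:{p..s}|lborel. f (t - e))"
      using s g2 by (intro set_integral_Icc_cong) auto
    also have "\<dots> = (LINT t:{p - e..s - e}|lborel. f t)" by (rule set_integral_Icc_shift)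
    also have "(LINT t:{0..p}|lborel. ?g t) = (LINT t:{0..p}|lborel. f t)" using I1 ends e' by auto
    also have "\<dots> = (LINT t:{0..p - e}|lborel. f t) + (p - (p - e)) *\<^sub>R cp"
      by (rule set_integral_Icc_flat[OF f _ _ fp]) (use ends e' in auto)
    also have "\<dots> + (LINT t:{p - e..s - e}|lborel. f t) =
        (LINT t:{0..p - e}|lborel. f t) + (LINT t:{p - e..s - e}|lborel. f t) + e *\<^sub>R cp" by simp
    also have "(LINT t:{0..p - e}|lborel. f t) + (LINT t:{p - e..s - e}|lborel. f t) = (LINT t:{0..s - e}|lborel. f t)"
      using s ends e' by (intro set_integral_Icc_combine[symmetric]) (auto intro: fi)
    finally show ?thesis .
  qed
  show "(LINT t:{0..s}|lborel. ?g t) = (LINT t:{0..s}|lborel. f t) + e *\<^sub>R (cp - cq)" if s: "s \<in> {q..L}"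
  proof -
    have "(LINT t:{0..s}|lborel. ?g t) = (LINT t:{0..q}|lborel. ?g t) + (LINT t:{q..s}|lborel. ?g t)"
      using s ends e' by (intro set_integral_Icc_combine) (auto intro: gi)
    also have "(LINT t:{q..s}|lborel. ?g t) = (LINT t:{q..s}|lborel. f t)"
      using s g3 by (intro set_integral_Icc_cong) auto
    also have "(LINT t:{0..q}|lborel. ?g t) = (LINT t:{0..q - e}|lborel. f t) + e *\<^sub>R cp" using I2 ends e' by auto
    also have "(LINT t:{0..q - e}|lborel. f t) = (LINT t:{0..q}|lborel. f t) + (q - e - q) *\<^sub>R cq"
      by (rule set_integral_Icc_flat[OF f _ _ fq]) (use ends e' in auto)
    also have "(LINT t:{0..q}|lborel. f t) + (q - e - q) *\<^sub>R cq + e *\<^sub>R cp + (LINT t:{q..s}|lborel. f t)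
       = ((LINT t:{0..q}|lborel. f t) + (LINT t:{q..s}|lborel. f t)) + e *\<^sub>R (cp - cq)"
      by (simp add: algebra_simps)
    also have "(LINT t:{0..q}|lborel. f t) + (LINT t:{q..s}|lborel. f t) = (LINT t:{0..s}|lborel. f t)"
      using s ends e' by (intro set_integral_Icc_combine[symmetric]) (auto intro: fi)
    finally show ?thesis .
  qed
qed

end

text \<open>The part of \<open>classC_rep\<close> concerning the tangent angle, with the curvature nonnegative everywhere.\<close>
definition angle_rep :: "real \<Rightarrow> (real \<Rightarrow> real) \<Rightarrow> (real \<Rightarrow> real) \<Rightarrow> bool" where
  "angle_rep L \<theta> k \<longleftrightarrow> set_integrable lborel {0..L} k \<and> set_integrable lborel {0..L} (\<lambda>s. (k s)\<^sup>2) \<and>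
     (\<forall>s. 0 \<le> k s) \<and> (\<forall>s\<in>{0..L}. \<theta> s = \<theta> 0 + (LINT t:{0..s}|lborel. k t)) \<and> \<theta> L = \<theta> 0 + 2 * pi"

text \<open>The curvature vanishes on both flats, so no correction terms arise: the shifted angle is
  the primitive of the shifted curvature, and the integral of the square is preserved.\<close>

lemma (in flat_ends) angle_rep_shift:
  assumes rep: "angle_rep L \<theta> k"
    and kp: "\<And>t. t \<in> {p - d..p + d} \<Longrightarrow> k t = 0" and kq: "\<And>t. t \<in> {q - d..q + d} \<Longrightarrow> k t = 0"
  shows "angle_rep L (shift_on p q e \<theta>) (shift_on p q e k)"
    and "elastic_energy L (shift_on p q e k) = elastic_energy L k"
proof -
  have k: "set_integrable lborel {0..L} k" "set_integrable lborel {0..L} (\<lambda>s. (k s)\<^sup>2)" "\<And>s. 0 \<le> k s"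
    "\<And>s. s \<in> {0..L} \<Longrightarrow> \<theta> s = \<theta> 0 + (LINT t:{0..s}|lborel. k t)" "\<theta> L = \<theta> 0 + 2 * pi"
    using rep unfolding angle_rep_def by blast+
  have sq: "(\<lambda>s. (shift_on p q e k s)\<^sup>2) = shift_on p q e (\<lambda>s. (k s)\<^sup>2)"
    by (auto simp: shift_on_def)
  have k2p: "(k t)\<^sup>2 = 0" if "t \<in> {p - d..p + d}" for t using kp[OF that] by simp
  have k2q: "(k t)\<^sup>2 = 0" if "t \<in> {q - d..q + d}" for t using kq[OF that] by simp
  note I = shift_on_integral[OF k(1) kp kq]
  note I2 = shift_on_integral[OF k(2) k2p k2q]
  have th0: "shift_on p q e \<theta> 0 = \<theta> 0"
    using ends d_pos by (simp add: shift_on_def)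
  have thL: "shift_on p q e \<theta> L = \<theta> L"
    using ends d_pos by (simp add: shift_on_def)
  have "shift_on p q e \<theta> s = \<theta> 0 + (LINT t:{0..s}|lborel. shift_on p q e k t)" if s: "s \<in> {0..L}" for s
  proof -
    consider "s \<in> {0..<p}" | "s \<in> {p..q}" | "s \<in> {q<..L}" using s by force
    then show ?thesis
    proof cases
      case 1
      then have s': "s \<notin> {p..q}" "s \<in> {0..p}" by auto
      moreover from s'(1) have "shift_on p q e \<theta> s = \<theta> s" unfolding shift_on_def by (rule if_not_P)
      ultimately show ?thesis using I(2)[of s] k(4)[OF s] by simp
    next
      case 2
      then have "s - e \<in> {0..L}" using ends e by auto
      moreover from 2 have "shift_on p q e \<theta> s = \<theta> (s - e)" unfolding shift_on_def by (rule if_P)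
      ultimately show ?thesis using 2 I(3)[of s] k(4)[of "s - e"] by simp
    next
      case 3
      then have s': "s \<notin> {p..q}" "s \<in> {q..L}" by auto
      moreover from s'(1) have "shift_on p q e \<theta> s = \<theta> s" unfolding shift_on_def by (rule if_not_P)
      ultimately show ?thesis using I(4)[of s] k(4)[OF s] by simp
    qed
  qed
  moreover have "0 \<le> shift_on p q e k s" for s using k(3) by (simp add: shift_on_def)
  ultimately show "angle_rep L (shift_on p q e \<theta>) (shift_on p q e k)"
    unfolding angle_rep_def th0 thL sq using I(1) I2(1) k(5) by blast
  have "L \<in> {q..L}" using ends e by auto
  then show "elastic_energy L (shift_on p q e k) = elastic_energy L k"
    unfolding elastic_energy_def sq using I2(4)[of L] by simp
qed

text \<open>Shifting needs the curvature to be zero on the flats and nonnegative at every point,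
  whereas the class grants this only almost everywhere. Changing k on a null set affects neither
  integrals nor energy.\<close>

lemma nonneg_representative:
  fixes k :: "real \<Rightarrow> real"
  assumes k: "set_integrable lborel {0..L} k" and k2: "set_integrable lborel {0..L} (\<lambda>s. (k s)\<^sup>2)"
    and nonneg: "AE s in lborel. s \<in> {0..L} \<longrightarrow> k s \<ge> 0"
    and F: "F \<in> sets borel" "AE s in lborel. s \<in> F \<inter> {0..L} \<longrightarrow> k s = 0"
  obtains k' where "set_integrable lborel {0..L} k'" "set_integrable lborel {0..L} (\<lambda>s. (k' s)\<^sup>2)"
    "\<And>s. 0 \<le> k' s" "\<And>s. s \<in> F \<Longrightarrow> k' s = 0"
    "\<And>s. s \<in> {0..L} \<Longrightarrow> (LINT t:{0..s}|lborel. k' t) = (LINT t:{0..s}|lborel. k t)"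
    "elastic_energy L k' = elastic_energy L k"
proof -
  \<comment> \<open>Integrability on \<open>{0..L}\<close> makes only this truncation measurable; k
    is arbitrary outside the interval.\<close>
  define \<kappa> where "\<kappa> = (\<lambda>s. indicator {0..L} s *\<^sub>R k s)"
  have [measurable]: "\<kappa> \<in> borel_measurable borel"
    using borel_measurable_integrable[OF k[unfolded set_integrable_def]] by (simp add: \<kappa>_def)
  define k' where "k' = (\<lambda>s. if \<kappa> s \<ge> 0 \<and> s \<notin> F then \<kappa> s else 0)"
  note F(1)[measurable]
  have [measurable]: "k' \<in> borel_measurable borel" unfolding k'_def by measurable
  have ae: "AE s in lborel. k' s = \<kappa> s"
    using nonneg F(2)
  proof eventually_elim
    case (elim s)
    then show ?case by (cases "s \<in> {0..L}") (simp_all add: k'_def \<kappa>_def)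
  qed
  have int_eq: "(LINT t:{0..s}|lborel. k' t) = (LINT t:{0..s}|lborel. k t)" if "s \<in> {0..L}" for s
  proof -
    have "(LINT t:{0..s}|lborel. k' t) = (LINT t:{0..s}|lborel. \<kappa> t)"
      unfolding set_lebesgue_integral_def by (rule integral_cong_AE) (use ae in auto)
    also have "\<dots> = (LINT t:{0..s}|lborel. k t)"
      using that by (intro set_integral_Icc_cong) (auto simp: \<kappa>_def)
    finally show ?thesis .
  qed
  have L1: "set_integrable lborel {0..L} k'"
  proof -
    have "integrable lborel \<kappa>" using k by (simp add: set_integrable_def \<kappa>_def)
    moreover have "AE s in lborel. \<kappa> s = indicator {0..L} s *\<^sub>R k' s"
      using ae by eventually_elim (simp add: \<kappa>_def split: split_indicator)
    ultimately show ?thesis unfolding set_integrable_def by (subst integrable_cong_AE[symmetric]) auto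
  qed
  have sq: "AE s in lborel. indicator {0..L} s *\<^sub>R (k s)\<^sup>2 = indicator {0..L} s *\<^sub>R (k' s)\<^sup>2"
    using ae by eventually_elim (simp add: \<kappa>_def split: split_indicator)
  have m: "(\<lambda>s. indicator {0..L} s *\<^sub>R (k s)\<^sup>2) \<in> borel_measurable lborel"
    using k2 unfolding set_integrable_def by (rule borel_measurable_integrable)
  have L2: "set_integrable lborel {0..L} (\<lambda>s. (k' s)\<^sup>2)"
    using k2 unfolding set_integrable_def by (subst integrable_cong_AE[OF _ m]) (use sq in auto)
  have "elastic_energy L k' = elastic_energy L k"
    unfolding elastic_energy_def set_lebesgue_integral_def
    by (subst integral_cong_AE[OF m _ sq]) auto
  moreover have "\<And>s. 0 \<le> k' s" "\<And>s. s \<in> F \<Longrightarrow> k' s = 0" by (auto simp: k'_def)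
  ultimately show thesis using that[of k'] L1 L2 int_eq by blast
qed

lemma curvature_zero_on_flat:
  fixes k :: "real \<Rightarrow> real"
  assumes k: "set_integrable lborel {0..L} k" and nonneg: "AE s in lborel. s \<in> {0..L} \<longrightarrow> k s \<ge> 0"
    and ab: "0 \<le> a" "a \<le> b" "b \<le> L"
    and eq: "(LINT t:{0..a}|lborel. k t) = (LINT t:{0..b}|lborel. k t)"
  shows "AE s in lborel. s \<in> {a..b} \<longrightarrow> k s = 0"
proof -
  have i: "set_integrable lborel {a..b} k" by (rule set_integrable_subset[OF k]) (use ab in auto)
  have "(LINT t:{a..b}|lborel. k t) = 0"
    using set_integral_Icc_combine[of 0 a b k] ab eq set_integrable_subset[OF k, of "{0..b}"] by auto
  moreover have "AE s in lborel. 0 \<le> indicator {a..b} s *\<^sub>R k s"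
    using nonneg by eventually_elim (use ab in \<open>auto simp: indicator_def\<close>)
  ultimately have "AE s in lborel. indicator {a..b} s *\<^sub>R k s = 0"
    using integral_nonneg_eq_0_iff_AE[OF i[unfolded set_integrable_def]] by (simp add: set_lebesgue_integral_def)
  then show ?thesis by eventually_elim (auto simp: indicator_def)
qed

section \<open>Maximizers in the four quadrants\<close>

text \<open>The bounds contain every difference of a tangent angle and a or b in
  \<open>four_directions\<close>. The isolated values -pi and 2 * pi are the cases that
  \<open>max_in_arcI\<close> absorbs by a full turn.\<close>

lemma sin_nonneg_cases:
  assumes "sin y \<ge> 0" "-pi \<le> y" "y \<le> 2 * pi"
  shows "y = -pi \<or> (0 \<le> y \<and> y \<le> pi) \<or> y = 2 * pi"
proof -
  have "sin y < 0" if "-pi < y" "y < 0" using sin_gt_zero[of "-y"] that by simp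
  moreover have "sin y < 0" if "pi < y" "y < 2 * pi" using that by (rule sin_lt_zero)
  ultimately show ?thesis using assms by argo
qed

lemma sin_nonpos_cases:
  assumes "sin y \<le> 0"
  shows "y \<le> 0 \<or> pi \<le> y"
  using sin_gt_zero[of y] assms by argo

context convex_closed_curve
begin

definition max_in_arc :: "complex \<Rightarrow> real \<Rightarrow> real \<Rightarrow> bool" where
  "max_in_arc v p q \<longleftrightarrow> (\<exists>t\<in>{p..q}. \<forall>r\<in>{0..L}. v \<bullet> \<gamma> r \<le> v \<bullet> \<gamma> t)"

lemma obtain_maximizer:
  obtains s where "s \<in> {0..L}" "\<And>r. r \<in> {0..L} \<Longrightarrow> v \<bullet> \<gamma> r \<le> v \<bullet> \<gamma> s"
proof -
  have "continuous_on {0..L} (\<lambda>s. v \<bullet> \<gamma> s)" by (intro continuous_intros curve_cont)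
  from continuous_attains_sup[OF _ _ this] show thesis using L_pos that by auto
qed

text \<open>An angle that fits only after a full turn must be \<open>\<theta> 0\<close> or
  \<open>\<theta> L\<close>. The maximizer then slides along the constant angle to that end of the
  parameter interval and is carried to the other end by closedness.\<close>

lemma max_in_arcI:
  assumes s: "s \<in> {0..L}" "\<And>r. r \<in> {0..L} \<Longrightarrow> v \<bullet> \<gamma> r \<le> v \<bullet> \<gamma> s"
    and pq: "0 \<le> p" "p \<le> q" "q \<le> L"
    and ang: "\<theta> s \<in> {\<theta> p..\<theta> q} \<or> \<theta> s + 2 * pi \<in> {\<theta> p..\<theta> q} \<or> \<theta> s - 2 * pi \<in> {\<theta> p..\<theta> q}"
  shows "max_in_arc v p q"
proof -
  have o: "v \<bullet> cis (\<theta> s) = 0" by (rule maximizer_orthogonal[OF s])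
  have *: "max_in_arc v p q" if t: "t \<in> {0..L}" "v \<bullet> \<gamma> t = v \<bullet> \<gamma> s" "\<theta> t \<in> {\<theta> p..\<theta> q}" for t
  proof -
    obtain t' where "t' \<in> {p..q}" "v \<bullet> \<gamma> t' = v \<bullet> \<gamma> t"
      using maximizer_in_arc[of t v p q] t s pq by auto
    then show ?thesis unfolding max_in_arc_def using s t by (intro bexI[of _ t']) auto
  qed
  have b: "\<theta> 0 \<le> \<theta> s" "\<theta> s \<le> \<theta> L" "\<theta> q \<le> \<theta> L" "\<theta> 0 \<le> \<theta> p"
    using angle_mono[of 0 s] angle_mono[of s L] angle_mono[of q L] angle_mono[of 0 p] s pq by auto
  from ang show ?thesis
  proof (elim disjE)
    assume "\<theta> s \<in> {\<theta> p..\<theta> q}" then show ?thesis using * s by blast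
  next
    assume a: "\<theta> s + 2 * pi \<in> {\<theta> p..\<theta> q}"
    then have e: "\<theta> s = \<theta> 0" "\<theta> s + 2 * pi = \<theta> L" using b angle_total by auto
    then have "v \<bullet> \<gamma> s = v \<bullet> \<gamma> 0" using inner_constI[of 0 s v] s o by auto
    then have "v \<bullet> \<gamma> L = v \<bullet> \<gamma> s" using curve_closed by simp
    moreover have "\<theta> L \<in> {\<theta> p..\<theta> q}" using a e by simp
    moreover have "L \<in> {0..L}" using L_pos by simp
    ultimately show ?thesis by (intro *)
  next
    assume a: "\<theta> s - 2 * pi \<in> {\<theta> p..\<theta> q}"
    then have e: "\<theta> s = \<theta> L" "\<theta> s - 2 * pi = \<theta> 0" using b angle_total by auto
    then have "v \<bullet> \<gamma> L = v \<bullet> \<gamma> s" using inner_constI[of s L v] s o by auto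
    then have "v \<bullet> \<gamma> 0 = v \<bullet> \<gamma> s" using curve_closed by simp
    moreover have "\<theta> 0 \<in> {\<theta> p..\<theta> q}" using a e by simp
    moreover have "0 \<in> {0..L}" using L_pos by simp
    ultimately show ?thesis by (intro *)
  qed
qed

lemma support_fn_max_in_arc:
  assumes "max_in_arc v p q" "0 \<le> p" "q \<le> L"
  obtains t where "t \<in> {p..q}" "support_fn (convex hull (\<gamma> ` {0..L})) v = v \<bullet> \<gamma> t"
proof -
  obtain t where t: "t \<in> {p..q}" "\<forall>r\<in>{0..L}. v \<bullet> \<gamma> r \<le> v \<bullet> \<gamma> t"
    using assms by (auto simp: max_in_arc_def)
  then have "support_fn (convex hull (\<gamma> ` {0..L})) v = v \<bullet> \<gamma> t"
    using assms by (intro support_fn_convex_hull) auto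
  then show thesis using that t by blast
qed

lemma support_fn_ge:
  assumes "t \<in> {0..L}"
  shows "v \<bullet> \<gamma> t \<le> support_fn (convex hull (\<gamma> ` {0..L})) v"
  using assms by (intro support_fn_upper compact_convex_hull compact_curve hull_inc) auto

end

text \<open>The angles a, b, a + pi, b + pi of the four sides occur in this order within one turn,
  so of the four arcs between them only the last one runs through the starting parameter.\<close>

locale four_directions = convex_closed_curve +
  fixes a b :: real
  assumes ab: "\<theta> 0 \<le> a" "a < b" "b < a + pi" "b + pi \<le> \<theta> L"
begin

text \<open>As v is the outer normal at s, \<open>v \<bullet> cis x\<close> equals
  \<open>norm v * sin (\<theta> s - x)\<close>. Signs of v against the side directions thus become
  conditions on the tangent angle.\<close>

lemma quadrant_maximizer:
  assumes v: "v \<noteq> 0"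
  obtains s where "s \<in> {0..L}" "\<And>r. r \<in> {0..L} \<Longrightarrow> v \<bullet> \<gamma> r \<le> v \<bullet> \<gamma> s" "\<theta> 0 \<le> \<theta> s" "\<theta> s \<le> \<theta> 0 + 2 * pi"
    "v \<bullet> cis a \<ge> 0 \<longleftrightarrow> sin (\<theta> s - a) \<ge> 0" "v \<bullet> cis a \<le> 0 \<longleftrightarrow> sin (\<theta> s - a) \<le> 0"
    "v \<bullet> cis b \<ge> 0 \<longleftrightarrow> sin (\<theta> s - b) \<ge> 0" "v \<bullet> cis b \<le> 0 \<longleftrightarrow> sin (\<theta> s - b) \<le> 0"
proof -
  obtain s where s: "s \<in> {0..L}" "\<And>r. r \<in> {0..L} \<Longrightarrow> v \<bullet> \<gamma> r \<le> v \<bullet> \<gamma> s" using obtain_maximizer by blast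
  have eq: "rcis (norm v) (\<theta> s - pi/2) = v" by (rule maximizer_angle[OF s])
  have "rcis r (t - pi/2) \<bullet> cis x = r * sin (t - x)" for r t x
    by (simp add: inner_complex_def cos_diff sin_diff algebra_simps)
  from this[of "norm v" "\<theta> s"] have "v \<bullet> cis x = norm v * sin (\<theta> s - x)" for x
    by (simp add: eq)
  then show thesis
    using that[OF s] v angle_mono[of 0 s] angle_mono[of s L] angle_total s
    by (simp add: zero_le_mult_iff mult_le_0_iff)
qed

text \<open>The suffixes here and below record the signs of \<open>v \<bullet> cis a\<close> and
  \<open>v \<bullet> cis b\<close>; each sign pattern singles out one of the four arcs between
  sides.\<close>

lemma max_in_arc_pm:
  assumes "v \<noteq> 0" "v \<bullet> cis a \<ge> 0" "v \<bullet> cis b \<le> 0" "0 \<le> p" "p \<le> q" "q \<le> L" "\<theta> p = a" "\<theta> q = b"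
  shows "max_in_arc v p q"
proof -
  obtain s where s: "s \<in> {0..L}" "\<And>r. r \<in> {0..L} \<Longrightarrow> v \<bullet> \<gamma> r \<le> v \<bullet> \<gamma> s"
    and b: "\<theta> 0 \<le> \<theta> s" "\<theta> s \<le> \<theta> 0 + 2 * pi" and sn: "sin (\<theta> s - a) \<ge> 0" "sin (\<theta> s - b) \<le> 0"
    using quadrant_maximizer[OF assms(1)] assms(2,3) by metis
  show ?thesis
  proof (rule max_in_arcI[OF s assms(4-6)])
    show "\<theta> s \<in> {\<theta> p..\<theta> q} \<or> \<theta> s + 2 * pi \<in> {\<theta> p..\<theta> q} \<or> \<theta> s - 2 * pi \<in> {\<theta> p..\<theta> q}"
      using sin_nonneg_cases[OF sn(1)] sin_nonpos_cases[OF sn(2)] ab b angle_total assms(7,8)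
      unfolding atLeastAtMost_iff by argo
  qed
qed

lemma max_in_arc_pp:
  assumes "v \<noteq> 0" "v \<bullet> cis a \<ge> 0" "v \<bullet> cis b \<ge> 0" "0 \<le> p" "p \<le> q" "q \<le> L" "\<theta> p = b" "\<theta> q = a + pi"
  shows "max_in_arc v p q"
proof -
  obtain s where s: "s \<in> {0..L}" "\<And>r. r \<in> {0..L} \<Longrightarrow> v \<bullet> \<gamma> r \<le> v \<bullet> \<gamma> s"
    and b: "\<theta> 0 \<le> \<theta> s" "\<theta> s \<le> \<theta> 0 + 2 * pi" and sn: "sin (\<theta> s - a) \<ge> 0" "sin (\<theta> s - b) \<ge> 0"
    using quadrant_maximizer[OF assms(1)] assms(2,3) by metis
  show ?thesis
  proof (rule max_in_arcI[OF s assms(4-6)])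
    show "\<theta> s \<in> {\<theta> p..\<theta> q} \<or> \<theta> s + 2 * pi \<in> {\<theta> p..\<theta> q} \<or> \<theta> s - 2 * pi \<in> {\<theta> p..\<theta> q}"
      using sin_nonneg_cases[OF sn(1)] sin_nonneg_cases[OF sn(2)] ab b angle_total assms(7,8)
      unfolding atLeastAtMost_iff by argo
  qed
qed

lemma max_in_arc_mp:
  assumes "v \<noteq> 0" "v \<bullet> cis a \<le> 0" "v \<bullet> cis b \<ge> 0" "0 \<le> p" "p \<le> q" "q \<le> L" "\<theta> p = a + pi" "\<theta> q = b + pi"
  shows "max_in_arc v p q"
proof -
  obtain s where s: "s \<in> {0..L}" "\<And>r. r \<in> {0..L} \<Longrightarrow> v \<bullet> \<gamma> r \<le> v \<bullet> \<gamma> s"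
    and b: "\<theta> 0 \<le> \<theta> s" "\<theta> s \<le> \<theta> 0 + 2 * pi" and sn: "sin (\<theta> s - a) \<le> 0" "sin (\<theta> s - b) \<ge> 0"
    using quadrant_maximizer[OF assms(1)] assms(2,3) by metis
  show ?thesis
  proof (rule max_in_arcI[OF s assms(4-6)])
    show "\<theta> s \<in> {\<theta> p..\<theta> q} \<or> \<theta> s + 2 * pi \<in> {\<theta> p..\<theta> q} \<or> \<theta> s - 2 * pi \<in> {\<theta> p..\<theta> q}"
      using sin_nonpos_cases[OF sn(1)] sin_nonneg_cases[OF sn(2)] ab b angle_total assms(7,8)
      unfolding atLeastAtMost_iff by argo
  qed
qed

text \<open>The remaining arc contains the starting point and is therefore split into two parameter
  intervals.\<close>

lemma max_in_arc_mm:
  assumes "v \<noteq> 0" "v \<bullet> cis a \<le> 0" "v \<bullet> cis b \<le> 0" "p \<in> {0..L}" "q \<in> {0..L}" "\<theta> p = a" "\<theta> q = b + pi"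
  shows "max_in_arc v 0 p \<or> max_in_arc v q L"
proof -
  obtain s where s: "s \<in> {0..L}" "\<And>r. r \<in> {0..L} \<Longrightarrow> v \<bullet> \<gamma> r \<le> v \<bullet> \<gamma> s"
    and b: "\<theta> 0 \<le> \<theta> s" "\<theta> s \<le> \<theta> 0 + 2 * pi" and sn: "sin (\<theta> s - a) \<le> 0" "sin (\<theta> s - b) \<le> 0"
    using quadrant_maximizer[OF assms(1)] assms(2,3) by metis
  have "\<theta> s \<le> a \<or> b + pi \<le> \<theta> s"
    using sin_nonpos_cases[OF sn(1)] sin_nonpos_cases[OF sn(2)] ab by argo
  then show ?thesis
  proof
    assume "\<theta> s \<le> a"
    then have "max_in_arc v 0 p" by (intro max_in_arcI[OF s]) (use assms b in auto)
    then show ?thesis ..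
  next
    assume "b + pi \<le> \<theta> s"
    then have "max_in_arc v q L" by (intro max_in_arcI[OF s]) (use assms b angle_total in auto)
    then show ?thesis ..
  qed
qed

end

text \<open>A maximizer of the new curve on the arc is the translate of a point of the old one. The
  one-sided form is kept because for the split arc the two curves may have their maximizers in
  different pieces.\<close>

lemma support_fn_shift_le:
  assumes C: "convex_closed_curve L \<theta> \<gamma>" and C': "convex_closed_curve L \<theta>' \<gamma>'"
    and m': "convex_closed_curve.max_in_arc L \<gamma>' v p q"
    and pq: "0 \<le> p - c" "q - c \<le> L" "0 \<le> p" "q \<le> L"
    and tr: "\<And>t. t \<in> {p..q} \<Longrightarrow> \<gamma>' t = \<gamma> (t - c) + T"
  shows "support_fn (convex hull (\<gamma>' ` {0..L})) v \<le> support_fn (convex hull (\<gamma> ` {0..L})) v + v \<bullet> T"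
proof -
  interpret C: convex_closed_curve L \<theta> \<gamma> by fact
  interpret C': convex_closed_curve L \<theta>' \<gamma>' by fact
  obtain t where t: "t \<in> {p..q}" "support_fn (convex hull (\<gamma>' ` {0..L})) v = v \<bullet> \<gamma>' t"
    using C'.support_fn_max_in_arc[OF m'] pq by blast
  then show ?thesis
    using tr[OF t(1)] C.support_fn_ge[of "t - c" v] pq by (auto simp: inner_add_right)
qed

lemma support_fn_shift:
  assumes C: "convex_closed_curve L \<theta> \<gamma>" and C': "convex_closed_curve L \<theta>' \<gamma>'"
    and m: "convex_closed_curve.max_in_arc L \<gamma> v (p - c) (q - c)" and m': "convex_closed_curve.max_in_arc L \<gamma>' v p q"
    and pq: "0 \<le> p - c" "q - c \<le> L" "0 \<le> p" "q \<le> L"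
    and tr: "\<And>t. t \<in> {p..q} \<Longrightarrow> \<gamma>' t = \<gamma> (t - c) + T"
  shows "support_fn (convex hull (\<gamma>' ` {0..L})) v = support_fn (convex hull (\<gamma> ` {0..L})) v + v \<bullet> T"
proof (rule antisym)
  show "support_fn (convex hull (\<gamma>' ` {0..L})) v \<le> support_fn (convex hull (\<gamma> ` {0..L})) v + v \<bullet> T"
    by (rule support_fn_shift_le[OF C C' m' pq tr])
  have "\<gamma> t = \<gamma>' (t - (- c)) + (- T)" if "t \<in> {p - c..q - c}" for t
    using tr[of "t + c"] that by auto
  then have "support_fn (convex hull (\<gamma> ` {0..L})) v \<le> support_fn (convex hull (\<gamma>' ` {0..L})) v + v \<bullet> (- T)"
    by (intro support_fn_shift_le[OF C' C m, of "-c"]) (use pq in auto)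
  then show "support_fn (convex hull (\<gamma> ` {0..L})) v + v \<bullet> T \<le> support_fn (convex hull (\<gamma>' ` {0..L})) v"
    by simp
qed

section \<open>Exchanging the lengths of two pairs of sides\<close>

lemma angle_rep_cont_mono:
  assumes rep: "angle_rep L \<theta> k" and L: "L > 0"
  shows angle_rep_cont: "continuous_on {0..L} \<theta>"
    and angle_rep_mono: "\<And>s t. 0 \<le> s \<Longrightarrow> s \<le> t \<Longrightarrow> t \<le> L \<Longrightarrow> \<theta> s \<le> \<theta> t"
proof -
  have k: "set_integrable lborel {0..L} k" "\<And>s. 0 \<le> k s"
    "\<And>s. s \<in> {0..L} \<Longrightarrow> \<theta> s = \<theta> 0 + (LINT t:{0..s}|lborel. k t)"
    using rep unfolding angle_rep_def by blast+
  have ki: "set_integrable lborel {x..y} k" if "0 \<le> x" "y \<le> L" for x y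
    by (rule set_integrable_subset[OF k(1)]) (use that in auto)
  have "continuous_on {0..L} (\<lambda>s. \<theta> 0 + integral {0..s} k)"
    using set_borel_integral_eq_integral(1)[OF k(1)]
    by (intro continuous_intros indefinite_integral_continuous_1)
  moreover have "\<theta> s = \<theta> 0 + integral {0..s} k" if "s \<in> {0..L}" for s
    using k(3)[OF that] set_borel_integral_eq_integral(2)[OF ki[of 0 s]] that by simp
  ultimately show "continuous_on {0..L} \<theta>"
    by (metis (no_types, lifting) continuous_on_cong)
  fix s t :: real assume st: "0 \<le> s" "s \<le> t" "t \<le> L"
  have "(LINT t:{0..t}|lborel. k t) = (LINT t:{0..s}|lborel. k t) + (LINT t:{s..t}|lborel. k t)"
    using st by (intro set_integral_Icc_combine ki) auto
  moreover have "(LINT t:{s..t}|lborel. k t) \<ge> 0"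
    unfolding set_lebesgue_integral_def using k(2) by (intro Bochner_Integration.integral_nonneg) simp
  ultimately show "\<theta> s \<le> \<theta> t" using k(3)[of s] k(3)[of t] st by simp
qed

lemma set_integrable_cis:
  fixes L :: real
  assumes "continuous_on {0..L} \<theta>"
  shows "set_integrable lborel {0..L} (\<lambda>s. cis (\<theta> s))"
proof (rule borel_integrable_atLeastAtMost')
  show "continuous_on {0..L} (\<lambda>s. cis (\<theta> s))" using assms by (intro continuous_intros)
qed

lemma angle_rep_convex_closed_curve:
  assumes rep: "angle_rep L \<theta> k" and L: "L > 0" and closed: "(LINT t:{0..L}|lborel. cis (\<theta> t)) = 0"
  shows "convex_closed_curve L \<theta> (boundary_curve x0 \<theta>)"
proof
  show "L > 0" by fact
  show cont: "continuous_on {0..L} \<theta>" by (rule angle_rep_cont[OF rep L])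
  show "\<theta> s \<le> \<theta> t" if "0 \<le> s" "s \<le> t" "t \<le> L" for s t by (rule angle_rep_mono[OF rep L that])
  show "\<theta> L = \<theta> 0 + 2 * pi" using rep by (auto simp: angle_rep_def)
  have ci: "set_integrable lborel {0..y} (\<lambda>s. cis (\<theta> s))" if "y \<le> L" for y
    by (rule set_integrable_subset[OF set_integrable_cis[OF cont]]) (use that in auto)
  have b: "boundary_curve x0 \<theta> s = x0 + integral {0..s} (\<lambda>t. cis (\<theta> t))" if "s \<in> {0..L}" for s
    unfolding boundary_curve_def using set_borel_integral_eq_integral(2)[OF ci, of s] that by simp
  have "boundary_curve x0 \<theta> L = x0" using closed by (simp add: boundary_curve_def)
  then show "boundary_curve x0 \<theta> L = boundary_curve x0 \<theta> 0" using b[of 0] L by simp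
  fix s assume s: "s \<in> {0..L}"
  have "continuous_on {0..L} (\<lambda>t. cis (\<theta> t))" by (intro continuous_intros cont)
  then have "((\<lambda>u. integral {0..u} (\<lambda>t. cis (\<theta> t))) has_vector_derivative cis (\<theta> s)) (at s within {0..L})"
    using s by (rule integral_has_vector_derivative)
  then have "((\<lambda>u. x0 + integral {0..u} (\<lambda>t. cis (\<theta> t))) has_vector_derivative cis (\<theta> s)) (at s within {0..L})"
    by (auto intro!: derivative_eq_intros)
  then show "(boundary_curve x0 \<theta> has_vector_derivative cis (\<theta> s)) (at s within {0..L})"
    by (rule has_vector_derivative_transform[OF s, rotated]) (use b in auto)
qed

lemma set_integral_cis_eq_0_iff:
  assumes "set_integrable lborel A (\<lambda>s. cis (\<theta> s))"
  shows "(LINT t:A|lborel. cis (\<theta> t)) = 0 \<longleftrightarrow>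
    (LINT t:A|lborel. cos (\<theta> t)) = 0 \<and> (LINT t:A|lborel. sin (\<theta> t)) = 0"
proof -
  have "Re (LINT t:A|lborel. cis (\<theta> t)) = (LINT t:A|lborel. cos (\<theta> t))"
    using integral_Re[OF assms[unfolded set_integrable_def]] by (simp add: set_lebesgue_integral_def)
  moreover have "Im (LINT t:A|lborel. cis (\<theta> t)) = (LINT t:A|lborel. sin (\<theta> t))"
    using integral_Im[OF assms[unfolded set_integrable_def]] by (simp add: set_lebesgue_integral_def)
  ultimately show ?thesis by (simp add: complex_eq_iff)
qed

lemma angle_rep_classC_rep:
  assumes rep: "angle_rep L \<theta> k" and L: "L > 0" and closed: "(LINT t:{0..L}|lborel. cis (\<theta> t)) = 0"
  shows "classC_rep (interior (convex hull (boundary_curve x0 \<theta> ` {0..L}))) L \<theta> k"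
proof -
  interpret convex_closed_curve L \<theta> "boundary_curve x0 \<theta>"
    by (rule angle_rep_convex_closed_curve[OF assms])
  have "bounded (interior (convex hull (boundary_curve x0 \<theta> ` {0..L})))"
    using compact_imp_bounded[OF compact_convex_hull[OF compact_curve]] bounded_subset interior_subset by blast
  moreover have "convex (interior (convex hull (boundary_curve x0 \<theta> ` {0..L})))"
    by (intro convex_interior convex_convex_hull)
  moreover have "AE s in lborel. s \<in> {0..L} \<longrightarrow> 0 \<le> k s"
    using rep unfolding angle_rep_def by simp
  ultimately show ?thesis
    using rep L closed set_integral_cis_eq_0_iff[OF set_integrable_cis[OF angle_cont]]
    unfolding classC_rep_def angle_rep_def by blast
qed

lemma measure_interior_hull:
  assumes "convex_closed_curve L \<theta> \<gamma>"
  shows "measure lborel (interior (convex hull (\<gamma> ` {0..L}))) = measure lebesgue (convex hull (\<gamma> ` {0..L}))"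
proof -
  interpret G: convex_closed_curve L \<theta> \<gamma> by fact
  let ?K = "convex hull (\<gamma> ` {0..L})"
  have b: "bounded ?K" by (intro compact_imp_bounded compact_convex_hull G.compact_curve)
  have "measure lborel (interior ?K) = measure lebesgue (interior ?K)" by simp
  also have "\<dots> = measure lebesgue ?K"
    by (rule measure_interior[OF b]) (simp add: negligible_convex_frontier)
  finally show ?thesis .
qed

text \<open>The points m1, ..., m4 are the middles of flat parameter intervals of half-width d, one
  for each side direction, in the order of the parametrization.\<close>

locale four_flats =
  fixes L :: real and \<theta> k :: "real \<Rightarrow> real" and m1 m2 m3 m4 d a b :: real and x0 :: complex
  assumes rep: "angle_rep L \<theta> k" and L: "L > 0" and closed: "(LINT t:{0..L}|lborel. cis (\<theta> t)) = 0"
    and order: "0 < d" "0 \<le> m1 - d" "m1 + d \<le> m2 - d" "m2 + d \<le> m3 - d" "m3 + d \<le> m4 - d" "m4 + d \<le> L"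
    and flat: "\<And>t. t \<in> {m1 - d..m1 + d} \<Longrightarrow> \<theta> t = a" "\<And>t. t \<in> {m2 - d..m2 + d} \<Longrightarrow> \<theta> t = b"
      "\<And>t. t \<in> {m3 - d..m3 + d} \<Longrightarrow> \<theta> t = a + pi" "\<And>t. t \<in> {m4 - d..m4 + d} \<Longrightarrow> \<theta> t = b + pi"
    and k0: "\<And>t. t \<in> {m1 - d..m1 + d} \<union> {m2 - d..m2 + d} \<union> {m3 - d..m3 + d} \<union> {m4 - d..m4 + d} \<Longrightarrow> k t = 0"
    and a_less_b: "a < b" "b < a + pi"
begin

text \<open>The inner shift moves length e from the side at m2 to the side at m1, the outer one from
  m4 to m3. As the sides at m3 and m4 run in opposite directions, the two displacements of the curve
  cancel.\<close>

definition "exchange e f = shift_on m3 m4 e (shift_on m1 m2 e f)" for e :: real and f :: "real \<Rightarrow> real"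

abbreviation "curve \<equiv> boundary_curve x0 \<theta>"
abbreviation "exchanged_curve e \<equiv> boundary_curve x0 (exchange e \<theta>)"

lemma flat_ends12: "\<bar>e\<bar> \<le> d \<Longrightarrow> flat_ends L m1 m2 d e"
  using order by unfold_locales auto

lemma flat_ends34: "\<bar>e\<bar> \<le> d \<Longrightarrow> flat_ends L m3 m4 d e"
  using order by unfold_locales auto

lemma shift12_far: "t > m2 \<Longrightarrow> shift_on m1 m2 e f t = f t"
  by (simp add: shift_on_def)

lemma exchange_angle_rep:
  assumes e: "\<bar>e\<bar> \<le> d"
  shows "angle_rep L (exchange e \<theta>) (exchange e k)"
    and "elastic_energy L (exchange e k) = elastic_energy L k"
proof -
  interpret S1: flat_ends L m1 m2 d e by (rule flat_ends12[OF e])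
  interpret S2: flat_ends L m3 m4 d e by (rule flat_ends34[OF e])
  note 1 = S1.angle_rep_shift[OF rep k0 k0]
  \<comment> \<open>Beyond m2 the first shift changes nothing, so the flats needed for the second
    one are intact.\<close>
  have z: "shift_on m1 m2 e k t = 0" if "t \<in> {m3 - d..m3 + d} \<or> t \<in> {m4 - d..m4 + d}" for t
    using that order by (subst shift12_far) (auto intro: k0)
  note 2 = S2.angle_rep_shift[OF 1(1) z z]
  show "angle_rep L (exchange e \<theta>) (exchange e k)" "elastic_energy L (exchange e k) = elastic_energy L k"
    unfolding exchange_def using 2 1(2) by simp_all
qed

lemma cis_shift: "(\<lambda>t. cis (shift_on p q e f t)) = shift_on p q e (\<lambda>t. cis (f t))"
  by (auto simp: shift_on_def)

text \<open>The offsets are the partial sums of \<open>e *\<^sub>R cis a\<close>,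
  \<open>- e *\<^sub>R cis b\<close>, \<open>- e *\<^sub>R cis a\<close>,
  \<open>e *\<^sub>R cis b\<close>, collected at m1, m2, m3, m4.\<close>

lemma exchanged_curve_eq:
  assumes e: "\<bar>e\<bar> \<le> d"
  shows "t \<in> {0..m1} \<Longrightarrow> exchanged_curve e t = curve t"
    and "t \<in> {m1..m2} \<Longrightarrow> exchanged_curve e t = curve (t - e) + e *\<^sub>R cis a"
    and "t \<in> {m2..m3} \<Longrightarrow> exchanged_curve e t = curve t + e *\<^sub>R (cis a - cis b)"
    and "t \<in> {m3..m4} \<Longrightarrow> exchanged_curve e t = curve (t - e) - e *\<^sub>R cis b"
    and "t \<in> {m4..L} \<Longrightarrow> exchanged_curve e t = curve t"
proof -
  interpret S1: flat_ends L m1 m2 d e by (rule flat_ends12[OF e])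
  interpret S2: flat_ends L m3 m4 d e by (rule flat_ends34[OF e])
  let ?f = "\<lambda>t. cis (\<theta> t)" and ?g = "shift_on m1 m2 e (\<lambda>t. cis (\<theta> t))"
  have f: "set_integrable lborel {0..L} ?f" by (rule set_integrable_cis[OF angle_rep_cont[OF rep L]])
  have f1: "?f t = cis a" if "t \<in> {m1 - d..m1 + d}" for t using flat(1)[OF that] by simp
  have f2: "?f t = cis b" if "t \<in> {m2 - d..m2 + d}" for t using flat(2)[OF that] by simp
  have f3: "?f t = - cis a" if "t \<in> {m3 - d..m3 + d}" for t using flat(3)[OF that] by (simp add: cis_mult[symmetric])
  have f4: "?f t = - cis b" if "t \<in> {m4 - d..m4 + d}" for t using flat(4)[OF that] by (simp add: cis_mult[symmetric])
  have g3: "?g t = - cis a" if "t \<in> {m3 - d..m3 + d}" for t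
    using f3[OF that] that order by (subst shift12_far) auto
  have g4: "?g t = - cis b" if "t \<in> {m4 - d..m4 + d}" for t
    using f4[OF that] that order by (subst shift12_far) auto
  note I1 = S1.shift_on_integral[OF f f1 f2]
  note I2 = S2.shift_on_integral[OF I1(1) g3 g4]
  have e': "-d \<le> e" "e \<le> d" using e by auto
  have c: "exchanged_curve e t = x0 + (LINT t:{0..t}|lborel. shift_on m3 m4 e ?g t)" for t
    unfolding boundary_curve_def exchange_def cis_shift ..
  show "exchanged_curve e t = curve t" if "t \<in> {0..m1}"
    using I2(2)[of t] I1(2)[of t] that order unfolding c unfolding boundary_curve_def by simp
  show "exchanged_curve e t = curve (t - e) + e *\<^sub>R cis a" if "t \<in> {m1..m2}"
    using I2(2)[of t] I1(3)[of t] that order unfolding c unfolding boundary_curve_def by simp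
  show "exchanged_curve e t = curve t + e *\<^sub>R (cis a - cis b)" if "t \<in> {m2..m3}"
    using I2(2)[of t] I1(4)[of t] that order unfolding c unfolding boundary_curve_def by simp
  show "exchanged_curve e t = curve (t - e) - e *\<^sub>R cis b" if "t \<in> {m3..m4}"
    using I2(3)[of t] I1(4)[of "t - e"] that order e' unfolding c unfolding boundary_curve_def by (simp add: scaleR_diff_right)
  show "exchanged_curve e t = curve t" if "t \<in> {m4..L}"
    using I2(4)[of t] I1(4)[of t] that order unfolding c unfolding boundary_curve_def by (simp add: algebra_simps)
qed

sublocale C: convex_closed_curve L \<theta> curve
  by (rule angle_rep_convex_closed_curve[OF rep L closed])

lemma exchange_closed:
  assumes e: "\<bar>e\<bar> \<le> d"
  shows "(LINT t:{0..L}|lborel. cis (exchange e \<theta> t)) = 0"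
proof -
  have "x0 + (LINT t:{0..L}|lborel. cis (exchange e \<theta> t)) = curve L"
    using exchanged_curve_eq(5)[OF e, of L] order by (simp add: boundary_curve_def)
  also have "\<dots> = x0" using closed by (simp add: boundary_curve_def)
  finally show ?thesis by simp
qed

lemma exchange_at:
  assumes e: "\<bar>e\<bar> \<le> d"
  shows "exchange e \<theta> m1 = a" "exchange e \<theta> m2 = b" "exchange e \<theta> m3 = a + pi" "exchange e \<theta> m4 = b + pi"
    "exchange e \<theta> 0 = \<theta> 0" "exchange e \<theta> L = \<theta> L"
  using order e flat(1)[of "m1 - e"] flat(2)[of "m2 - e"] flat(3)[of "m3 - e"] flat(4)[of "m4 - e"]
  by (auto simp: exchange_def shift_on_def abs_le_iff)

lemma exchanged_convex_closed_curve:
  assumes e: "\<bar>e\<bar> \<le> d"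
  shows "convex_closed_curve L (exchange e \<theta>) (exchanged_curve e)"
  by (rule angle_rep_convex_closed_curve[OF exchange_angle_rep(1)[OF e] L exchange_closed[OF e]])

lemma four_directions:
  "four_directions L \<theta> curve a b"
  and exchanged_four_directions: "\<bar>e\<bar> \<le> d \<Longrightarrow> four_directions L (exchange e \<theta>) (exchanged_curve e) a b"
proof -
  have m: "\<theta> m1 = a" "\<theta> m4 = b + pi" using flat(1)[of m1] flat(4)[of m4] order by auto
  have "\<theta> 0 \<le> a" "b + pi \<le> \<theta> L" using C.angle_mono[of 0 m1] C.angle_mono[of m4 L] order m by auto
  then show "four_directions L \<theta> curve a b"
    "\<bar>e\<bar> \<le> d \<Longrightarrow> four_directions L (exchange e \<theta>) (exchanged_curve e) a b"
    using a_less_b C.convex_closed_curve_axioms exchanged_convex_closed_curve exchange_at(5,6)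
    by (auto simp: four_directions_def four_directions_axioms_def)
qed

text \<open>Multiplication by \<open>- \<i>\<close> turns a tangent into the outer normal: here that
  of the side with angle b, and in \<open>dual_b\<close> that of the side with angle a + pi. The
  sine normalizes them to a dual basis of \<open>cis a\<close>, \<open>cis b\<close>.\<close>

definition "dual_a = (1 / sin (b - a)) *\<^sub>R (- \<i> * cis b)"
definition "dual_b = (1 / sin (b - a)) *\<^sub>R (\<i> * cis a)"

sublocale frame: dual_frame dual_a dual_b "cis a" "cis b"
proof
  define r where "r = sin (b - a)"
  have r: "r \<noteq> 0" using a_less_b sin_gt_zero[of "b - a"] by (auto simp: r_def)
  have A: "dual_a \<bullet> x = (sin b * Re x - cos b * Im x) / r" and B: "dual_b \<bullet> x = (cos a * Im x - sin a * Re x) / r" for x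
    by (simp_all add: dual_a_def dual_b_def inner_complex_def r_def[symmetric] diff_divide_distrib)
  have r': "r = sin b * cos a - cos b * sin a" by (simp add: r_def sin_diff)
  show "dual_a \<bullet> cis a = 1" "dual_a \<bullet> cis b = 0" "dual_b \<bullet> cis a = 0" "dual_b \<bullet> cis b = 1"
    unfolding A B using r by (simp_all add: r' mult.commute)
  fix x :: complex
  have "(sin b * Re x - cos b * Im x) * cos a + (cos a * Im x - sin a * Re x) * cos b = Re x * r"
    "(sin b * Re x - cos b * Im x) * sin a + (cos a * Im x - sin a * Re x) * sin b = Im x * r"
    by (simp_all add: r' algebra_simps)
  then show "x = (dual_a \<bullet> x) *\<^sub>R cis a + (dual_b \<bullet> x) *\<^sub>R cis b"
    unfolding A B using r by (simp add: complex_eq_iff add_divide_distrib[symmetric] eq_divide_eq)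
qed

text \<open>The sign pattern of v confines maximizers of both curves to corresponding arcs, where
  one curve is a translate of the other. The parameter offset is e on the arcs that are moved and 0
  elsewhere.\<close>

lemma exchange_side_exchange:
  assumes e: "\<bar>e\<bar> \<le> d"
  shows "frame.side_exchange e (convex hull (curve ` {0..L})) (convex hull (exchanged_curve e ` {0..L}))"
proof -
  note C = C.convex_closed_curve_axioms and C' = exchanged_convex_closed_curve[OF e]
  interpret Q: four_directions L \<theta> curve a b by (rule four_directions)
  interpret Q': four_directions L "exchange e \<theta>" "exchanged_curve e" a b by (rule exchanged_four_directions[OF e])
  let ?h = "support_fn (convex hull (curve ` {0..L}))" and ?h' = "support_fn (convex hull (exchanged_curve e ` {0..L}))"
  have e': "-d \<le> e" "e \<le> d" using e by auto
  have th: "\<theta> m1 = a" "\<theta> m2 = b" "\<theta> m3 = a + pi" "\<theta> m4 = b + pi"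
    "\<theta> (m1 - e) = a" "\<theta> (m2 - e) = b" "\<theta> (m3 - e) = a + pi" "\<theta> (m4 - e) = b + pi"
    using flat(1)[of m1] flat(2)[of m2] flat(3)[of m3] flat(4)[of m4] 
       flat(1)[of "m1 - e"] flat(2)[of "m2 - e"] flat(3)[of "m3 - e"] flat(4)[of "m4 - e"] order e' by auto
  note at = exchange_at[OF e] and tr = exchanged_curve_eq[OF e]
  \<comment> \<open>The zero vector determines no tangent angle and is treated apart.\<close>
  have zero: "?h 0 = 0" "?h' 0 = 0"
    using support_fn_convex_hull[of "curve 0" "curve ` {0..L}" 0]
      support_fn_convex_hull[of "exchanged_curve e 0" "exchanged_curve e ` {0..L}" 0] L by auto
  have pp: "?h' v = ?h v + v \<bullet> (e *\<^sub>R (cis a - cis b))" if "v \<noteq> 0" "v \<bullet> cis a \<ge> 0" "v \<bullet> cis b \<ge> 0" for v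
    by (rule support_fn_shift[OF C C', of v m2 0 m3])
       (use that order e' th at tr in \<open>auto intro!: Q.max_in_arc_pp Q'.max_in_arc_pp\<close>)
  have pm: "?h' v = ?h v + v \<bullet> (e *\<^sub>R cis a)" if "v \<noteq> 0" "v \<bullet> cis a \<ge> 0" "v \<bullet> cis b \<le> 0" for v
    by (rule support_fn_shift[OF C C', of v m1 e m2])
       (use that order e' th at tr in \<open>auto intro!: Q.max_in_arc_pm Q'.max_in_arc_pm\<close>)
  have mp: "?h' v = ?h v + v \<bullet> (- e *\<^sub>R cis b)" if "v \<noteq> 0" "v \<bullet> cis a \<le> 0" "v \<bullet> cis b \<ge> 0" for v
    by (rule support_fn_shift[OF C C', of v m3 e m4])
       (use that order e' th at tr in \<open>auto intro!: Q.max_in_arc_mp Q'.max_in_arc_mp\<close>)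
  have mm: "?h' v = ?h v" if v: "v \<noteq> 0" "v \<bullet> cis a \<le> 0" "v \<bullet> cis b \<le> 0" for v
  proof (rule antisym)
    have "Q'.max_in_arc v 0 m1 \<or> Q'.max_in_arc v m4 L"
      using order by (intro Q'.max_in_arc_mm v at) auto
    then show "?h' v \<le> ?h v"
    proof
      assume "Q'.max_in_arc v 0 m1"
      from support_fn_shift_le[OF C C' this, of 0 0] tr(1) order show ?thesis by auto
    next
      assume "Q'.max_in_arc v m4 L"
      from support_fn_shift_le[OF C C' this, of 0 0] tr(5) order show ?thesis by auto
    qed
    have "C.max_in_arc v 0 m1 \<or> C.max_in_arc v m4 L"
      using order by (intro Q.max_in_arc_mm v th) auto
    then show "?h v \<le> ?h' v"
    proof
      assume "C.max_in_arc v 0 m1"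
      from support_fn_shift_le[OF C' C this, of 0 0] tr(1) order show ?thesis by auto
    next
      assume "C.max_in_arc v m4 L"
      from support_fn_shift_le[OF C' C this, of 0 0] tr(5) order show ?thesis by auto
    qed
  qed
  show ?thesis unfolding frame.side_exchange_def
  proof
    fix v
    show "(v \<bullet> cis a \<ge> 0 \<longrightarrow> v \<bullet> cis b \<ge> 0 \<longrightarrow> ?h' v = ?h v + v \<bullet> (e *\<^sub>R (cis a - cis b))) \<and>
      (v \<bullet> cis a \<ge> 0 \<longrightarrow> v \<bullet> cis b \<le> 0 \<longrightarrow> ?h' v = ?h v + v \<bullet> (e *\<^sub>R cis a)) \<and>
      (v \<bullet> cis a \<le> 0 \<longrightarrow> v \<bullet> cis b \<ge> 0 \<longrightarrow> ?h' v = ?h v + v \<bullet> (- e *\<^sub>R cis b)) \<and>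
      (v \<bullet> cis a \<le> 0 \<longrightarrow> v \<bullet> cis b \<le> 0 \<longrightarrow> ?h' v = ?h v)"
      by (cases "v = 0") (simp add: zero, use pp pm mp mm in blast)
  qed
qed

lemma not_minimal:
  assumes "\<mu> > 0"
  obtains \<Omega>' \<theta>' k' where "classC_rep \<Omega>' L \<theta>' k'"
    "J_fun \<mu> \<Omega>' L k' < J_fun \<mu> (interior (convex hull (curve ` {0..L}))) L k"
proof -
  let ?K = "convex hull (curve ` {0..L})" and ?K' = "\<lambda>e. convex hull (exchanged_curve e ` {0..L})"
  have d: "\<bar>d\<bar> \<le> d" "\<bar>- d\<bar> \<le> d" using order by auto
  have K: "compact ?K" "convex ?K" "?K \<noteq> {}"
    using L by (auto intro: compact_convex_hull C.compact_curve)
  have K': "compact (?K' e)" "convex (?K' e)" "?K' e \<noteq> {}" if "\<bar>e\<bar> \<le> d" for e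
    using L convex_closed_curve.compact_curve[OF exchanged_convex_closed_curve[OF that]] by (auto intro: compact_convex_hull)
  have "measure lebesgue (?K' d) + measure lebesgue (?K' (-d)) < 2 * measure lebesgue ?K"
    by (rule frame.side_exchange_concave[OF K K'[OF d(1)] K'[OF d(2)] order(1)
         exchange_side_exchange[OF d(1)] exchange_side_exchange[OF d(2)]])
  then have "measure lebesgue (?K' d) < measure lebesgue ?K \<or> measure lebesgue (?K' (-d)) < measure lebesgue ?K"
    by linarith
  then obtain e where e: "\<bar>e\<bar> \<le> d" "measure lebesgue (?K' e) < measure lebesgue ?K" using d by blast
  have "J_fun \<mu> (interior (?K' e)) L (exchange e k) < J_fun \<mu> (interior ?K) L k"
    unfolding J_fun_def exchange_angle_rep(2)[OF e(1)]
      measure_interior_hull[OF exchanged_convex_closed_curve[OF e(1)]] measure_interior_hull[OF C.convex_closed_curve_axioms]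
    using e(2) assms by simp
  then show thesis
    using that[OF angle_rep_classC_rep[OF exchange_angle_rep(1)[OF e(1)] L exchange_closed[OF e(1)]]] by blast
qed

end

section \<open>Boundary segments\<close>

text \<open>Either of the two faces may come first along the curve. Hence \<phi> is the smaller of
  the two angles, and the sign of r records which face it belongs to.\<close>

lemma (in convex_closed_curve) antipodal_flat_intervals:
  assumes v: "v \<noteq> 0"
    and face: "x \<in> convex hull (\<gamma> ` {0..L})" "y \<in> convex hull (\<gamma> ` {0..L})" "x \<noteq> y"
      "\<And>z. z \<in> convex hull (\<gamma> ` {0..L}) \<Longrightarrow> v \<bullet> z \<le> v \<bullet> x" "\<And>z. z \<in> convex hull (\<gamma> ` {0..L}) \<Longrightarrow> v \<bullet> z \<le> v \<bullet> y"
    and face': "x' \<in> convex hull (\<gamma> ` {0..L})" "y' \<in> convex hull (\<gamma> ` {0..L})" "x' \<noteq> y'"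
      "\<And>z. z \<in> convex hull (\<gamma> ` {0..L}) \<Longrightarrow> - v \<bullet> z \<le> - v \<bullet> x'" "\<And>z. z \<in> convex hull (\<gamma> ` {0..L}) \<Longrightarrow> - v \<bullet> z \<le> - v \<bullet> y'"
  obtains a b a' b' \<phi> r where "0 \<le> a" "a < b" "b \<le> L" "\<And>t. t \<in> {a..b} \<Longrightarrow> \<theta> t = \<phi>"
    "0 \<le> a'" "a' < b'" "b' \<le> L" "\<And>t. t \<in> {a'..b'} \<Longrightarrow> \<theta> t = \<phi> + pi" "r *\<^sub>R (\<i> * cis \<phi>) = v"
proof -
  note found = that
  obtain a b \<phi> where ab: "0 \<le> a" "a < b" "b \<le> L" "\<And>t. t \<in> {a..b} \<Longrightarrow> \<theta> t = \<phi>" and vphi: "rcis (norm v) (\<phi> - pi/2) = v"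
    using flat_interval_of_face[OF v face] by blast
  have "- v \<noteq> 0" using v by simp
  then obtain a' b' \<phi>' where ab': "0 \<le> a'" "a' < b'" "b' \<le> L" "\<And>t. t \<in> {a'..b'} \<Longrightarrow> \<theta> t = \<phi>'"
    and vphi': "rcis (norm (-v)) (\<phi>' - pi/2) = -v"
    using flat_interval_of_face[OF _ face'] by blast
  have rc: "rcis r (x - pi/2) = (- r) *\<^sub>R (\<i> * cis x)" for r x
    by (simp add: complex_eq_iff cos_diff sin_diff)
  have v1: "(- norm v) *\<^sub>R (\<i> * cis \<phi>) = v" and v2: "(norm v) *\<^sub>R (\<i> * cis \<phi>') = v"
    using vphi vphi' by (simp_all add: rc equation_minus_iff)
  have "(norm v) *\<^sub>R (\<i> * cis \<phi>') = (- norm v) *\<^sub>R (\<i> * cis \<phi>)" by (simp only: v1 v2)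
  then have "(norm v) *\<^sub>R (\<i> * cis \<phi>') = (norm v) *\<^sub>R (- (\<i> * cis \<phi>))" by simp
  then have "\<i> * cis \<phi>' = - (\<i> * cis \<phi>)" using v by (metis norm_eq_zero scaleR_cancel_left)
  then have neg: "cis \<phi>' = - cis \<phi>" by (metis complex_i_not_zero mult_cancel_left mult_minus_right)
  have "\<phi> = \<theta> a" "\<phi>' = \<theta> a'" using ab(4)[of a] ab'(4)[of a'] ab ab' by auto
  then have rng: "\<phi> \<in> {\<theta> 0..\<theta> 0 + 2 * pi}" "\<phi>' \<in> {\<theta> 0..\<theta> 0 + 2 * pi}"
    using angle_mono[of 0 a] angle_mono[of a L] angle_mono[of 0 a'] angle_mono[of a' L] ab ab' angle_total by auto
  have "cis (\<phi>' - \<phi>) = cis pi"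
    using neg by (metis cis_divide cis_neq_zero cis_pi divide_minus_left divide_self)
  then have "cos (\<phi>' - \<phi> - pi) = 1" by (simp add: complex_eq_iff cos_diff)
  then obtain n :: int where n: "\<phi>' - \<phi> - pi = of_int n * 2 * pi" using cos_one_2pi_int by blast
  have "\<bar>\<phi>' - \<phi>\<bar> \<le> 2 * pi" using rng by auto
  \<comment> \<open>Both angles lie in one turn, so the odd multiple of pi between them can only be
    pi or -pi.\<close>
  then have "(of_int n * 2) * pi \<le> 1 * pi" "(-3) * pi \<le> (of_int n * 2) * pi"
    unfolding n[symmetric] by (simp_all only: abs_le_iff) linarith+
  then have "of_int n * 2 \<le> (1::real)" "(-3::real) \<le> of_int n * 2"
    using pi_gt_zero mult_le_cancel_right_pos[of pi] by blast+
  then have "n = 0 \<or> n = -1" by linarith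
  then show thesis
  proof
    assume "n = 0"
    then have "\<phi>' = \<phi> + pi" using n by simp
    then show thesis using found[OF ab ab'(1-3) _ v1] ab'(4) by blast
  next
    assume "n = -1"
    then have "\<phi> = \<phi>' + pi" using n by simp
    then show thesis using found[OF ab' ab(1-3) _ v2] ab(4) by blast
  qed
qed

lemma classC_rep_angle_rep:
  assumes C: "classC_rep \<Omega> L \<theta> k" and F: "F \<in> sets borel" "AE s in lborel. s \<in> F \<inter> {0..L} \<longrightarrow> k s = 0"
  obtains k' where "angle_rep L \<theta> k'" "\<And>s. s \<in> F \<Longrightarrow> k' s = 0" "elastic_energy L k' = elastic_energy L k"
    "L > 0" "(LINT t:{0..L}|lborel. cis (\<theta> t)) = 0"
proof -
  have c: "L > 0" "set_integrable lborel {0..L} k" "set_integrable lborel {0..L} (\<lambda>s. (k s)\<^sup>2)"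
     "AE s in lborel. s \<in> {0..L} \<longrightarrow> k s \<ge> 0"
     "\<forall>s\<in>{0..L}. \<theta> s = \<theta> 0 + (LINT t:{0..s}|lborel. k t)" "\<theta> L = \<theta> 0 + 2 * pi"
     "(LINT t:{0..L}|lborel. cos (\<theta> t)) = 0" "(LINT t:{0..L}|lborel. sin (\<theta> t)) = 0"
    using C unfolding classC_rep_def by blast+
  obtain k' where k': "set_integrable lborel {0..L} k'" "set_integrable lborel {0..L} (\<lambda>s. (k' s)\<^sup>2)"
    "\<And>s. 0 \<le> k' s" "\<And>s. s \<in> F \<Longrightarrow> k' s = 0"
    "\<And>s. s \<in> {0..L} \<Longrightarrow> (LINT t:{0..s}|lborel. k' t) = (LINT t:{0..s}|lborel. k t)"
    "elastic_energy L k' = elastic_energy L k"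
    using nonneg_representative[OF c(2-4) F] by blast
  have "\<forall>s\<in>{0..L}. \<theta> s = \<theta> 0 + (LINT t:{0..s}|lborel. k' t)"
    using c(5) k'(5) by metis
  then have rep: "angle_rep L \<theta> k'"
    unfolding angle_rep_def using k' c(6) by blast
  have "(LINT t:{0..L}|lborel. cis (\<theta> t)) = 0"
    using set_integral_cis_eq_0_iff[OF set_integrable_cis[OF angle_rep_cont[OF rep c(1)]]] c(7,8) by blast
  then show thesis using that rep k' c(1) by blast
qed

lemma classC_rep_angle_rep':
  assumes C: "classC_rep \<Omega> L \<theta> k"
  obtains k' where "angle_rep L \<theta> k'" "L > 0" "(LINT t:{0..L}|lborel. cis (\<theta> t)) = 0"
  by (rule classC_rep_angle_rep[OF C, of "{}"]) (simp_all add: that)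

text \<open>Brings the data into the form of \<open>four_flats\<close>: monotonicity of the angle
  orders the intervals, and the curvature is made zero everywhere on them without changing the
  energy, so that J is unaffected.\<close>

lemma four_flat_intervals_not_minimal:
  assumes \<mu>: "\<mu> > 0" and C: "classC_rep \<Omega> L \<theta> k" and \<Omega>: "\<Omega> = interior (convex hull (boundary_curve x0 \<theta> ` {0..L}))"
    and 1: "0 \<le> a1" "a1 < b1" "b1 \<le> L" "\<And>t. t \<in> {a1..b1} \<Longrightarrow> \<theta> t = \<phi>"
    and 2: "0 \<le> a2" "a2 < b2" "b2 \<le> L" "\<And>t. t \<in> {a2..b2} \<Longrightarrow> \<theta> t = \<psi>"
    and 3: "0 \<le> a3" "a3 < b3" "b3 \<le> L" "\<And>t. t \<in> {a3..b3} \<Longrightarrow> \<theta> t = \<phi> + pi"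
    and 4: "0 \<le> a4" "a4 < b4" "b4 \<le> L" "\<And>t. t \<in> {a4..b4} \<Longrightarrow> \<theta> t = \<psi> + pi"
    and ang: "\<phi> < \<psi>" "\<psi> < \<phi> + pi"
  obtains \<Omega>' \<theta>' k' where "classC_rep \<Omega>' L \<theta>' k'" "J_fun \<mu> \<Omega>' L k' < J_fun \<mu> \<Omega> L k"
proof -
  have c: "set_integrable lborel {0..L} k" "AE s in lborel. s \<in> {0..L} \<longrightarrow> k s \<ge> 0"
     "\<And>s. s \<in> {0..L} \<Longrightarrow> \<theta> s = \<theta> 0 + (LINT t:{0..s}|lborel. k t)"
    using C unfolding classC_rep_def by blast+
  have zero: "AE s in lborel. s \<in> {a..b} \<longrightarrow> k s = 0" if "0 \<le> a" "a < b" "b \<le> L" "\<And>t. t \<in> {a..b} \<Longrightarrow> \<theta> t = x" for a b x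
  proof (rule curvature_zero_on_flat[OF c(1,2)])
    have "\<theta> a = \<theta> b" using that(4)[of a] that(4)[of b] that(2) by simp
    then show "(LINT t:{0..a}|lborel. k t) = (LINT t:{0..b}|lborel. k t)"
      using c(3)[of a] c(3)[of b] that by simp
  qed (use that in auto)
  define F where "F = {a1..b1} \<union> {a2..b2} \<union> {a3..b3} \<union> {a4..b4}"
  have "AE s in lborel. s \<in> F \<inter> {0..L} \<longrightarrow> k s = 0"
  proof -
    have "AE s in lborel. s \<in> {a1..b1} \<longrightarrow> k s = 0" by (rule zero) (fact 1)+
    moreover have "AE s in lborel. s \<in> {a2..b2} \<longrightarrow> k s = 0" by (rule zero) (fact 2)+
    moreover have "AE s in lborel. s \<in> {a3..b3} \<longrightarrow> k s = 0" by (rule zero) (fact 3)+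
    moreover have "AE s in lborel. s \<in> {a4..b4} \<longrightarrow> k s = 0" by (rule zero) (fact 4)+
    ultimately show ?thesis by eventually_elim (auto simp: F_def)
  qed
  moreover have "F \<in> sets borel" by (simp add: F_def)
  ultimately obtain k' where k': "angle_rep L \<theta> k'" "\<And>s. s \<in> F \<Longrightarrow> k' s = 0" "elastic_energy L k' = elastic_energy L k"
    "L > 0" "(LINT t:{0..L}|lborel. cis (\<theta> t)) = 0"
    using classC_rep_angle_rep[OF C] by blast
  have less: "b < a'" if "\<theta> b < \<theta> a'" "b \<in> {0..L}" "a' \<in> {0..L}" for b a'
    using angle_rep_mono[OF k'(1,4), of a' b] that by (meson atLeastAtMost_iff leD not_le_imp_less)
  have "b1 < a2" by (rule less) (use 1(4)[of b1] 2(4)[of a2] 1 2 ang in auto)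
  have "b2 < a3" by (rule less) (use 2(4)[of b2] 3(4)[of a3] 3 2 ang in auto)
  have "b3 < a4" by (rule less) (use 3(4)[of b3] 4(4)[of a4] 3 4 ang in auto)
  \<comment> \<open>The largest common half-width for which the intervals around the four midpoints
    stay flat.\<close>
  define d where "d = min (min ((b1 - a1)/2) ((b2 - a2)/2)) (min ((b3 - a3)/2) ((b4 - a4)/2))"
  have d: "d > 0" "d \<le> (b1 - a1)/2" "d \<le> (b2 - a2)/2" "d \<le> (b3 - a3)/2" "d \<le> (b4 - a4)/2"
    using 1(2) 2(2) 3(2) 4(2) unfolding d_def
    by (simp, auto simp only: intro: min.coboundedI1 min.coboundedI2)
  interpret four_flats L \<theta> k' "(a1 + b1)/2" "(a2 + b2)/2" "(a3 + b3)/2" "(a4 + b4)/2" d \<phi> \<psi> x0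
  proof
    show "0 \<le> (a1 + b1)/2 - d" "(a1 + b1)/2 + d \<le> (a2 + b2)/2 - d" "(a2 + b2)/2 + d \<le> (a3 + b3)/2 - d"
       "(a3 + b3)/2 + d \<le> (a4 + b4)/2 - d" "(a4 + b4)/2 + d \<le> L"
      using d 1(1-3) 2(1-3) 3(1-3) 4(1-3) \<open>b1 < a2\<close> \<open>b2 < a3\<close> \<open>b3 < a4\<close> by (auto simp: field_simps)
    have sub: "{(a1 + b1)/2 - d..(a1 + b1)/2 + d} \<subseteq> {a1..b1}" "{(a2 + b2)/2 - d..(a2 + b2)/2 + d} \<subseteq> {a2..b2}"
      "{(a3 + b3)/2 - d..(a3 + b3)/2 + d} \<subseteq> {a3..b3}" "{(a4 + b4)/2 - d..(a4 + b4)/2 + d} \<subseteq> {a4..b4}"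
      using d by (auto simp: field_simps)
    show "\<theta> t = \<phi>" if "t \<in> {(a1 + b1)/2 - d..(a1 + b1)/2 + d}" for t using 1(4) sub that by blast
    show "\<theta> t = \<psi>" if "t \<in> {(a2 + b2)/2 - d..(a2 + b2)/2 + d}" for t using 2(4) sub that by blast
    show "\<theta> t = \<phi> + pi" if "t \<in> {(a3 + b3)/2 - d..(a3 + b3)/2 + d}" for t using 3(4) sub that by blast
    show "\<theta> t = \<psi> + pi" if "t \<in> {(a4 + b4)/2 - d..(a4 + b4)/2 + d}" for t using 4(4) sub that by blast
    show "k' t = 0" if "t \<in> {(a1 + b1)/2 - d..(a1 + b1)/2 + d} \<union> {(a2 + b2)/2 - d..(a2 + b2)/2 + d}
       \<union> {(a3 + b3)/2 - d..(a3 + b3)/2 + d} \<union> {(a4 + b4)/2 - d..(a4 + b4)/2 + d}" for t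
      by (rule k'(2)) (use sub that in \<open>unfold F_def, blast\<close>)
  qed (fact k' d ang)+
  obtain \<Omega>' \<theta>' k'' where "classC_rep \<Omega>' L \<theta>' k''" "J_fun \<mu> \<Omega>' L k'' < J_fun \<mu> \<Omega> L k'"
    using not_minimal[OF \<mu>] unfolding \<Omega> by blast
  then show thesis using that k'(3) by (simp add: J_fun_def)
qed

text \<open>A supporting line at the midpoint must contain both endpoints. It meets K in a face that
  is itself a segment of the frontier, and maximality identifies this face with S.\<close>

lemma boundary_segment_normal:
  fixes K :: "complex set"
  assumes K: "compact K" "convex K" "interior K \<noteq> {}" and S: "S \<in> maximal_boundary_segments (interior K)"
  obtains v a b where "v \<noteq> 0" "a \<noteq> b" "a \<in> K" "b \<in> K" "\<forall>z\<in>K. v \<bullet> z \<le> v \<bullet> a" "v \<bullet> b = v \<bullet> a"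
    "\<forall>z\<in>interior K. v \<bullet> z < v \<bullet> a" "S = {z \<in> K. v \<bullet> z = v \<bullet> a}"
proof -
  have fr: "frontier (interior K) = K - interior K"
    using convex_closure_interior[OF K(2,3)] K(1) by (simp add: frontier_def compact_imp_closed)
  have "\<exists>a b. a \<noteq> b \<and> S = closed_segment a b \<and> S \<subseteq> K - interior K \<and>
      (\<forall>c d. S \<subseteq> closed_segment c d \<and> closed_segment c d \<subseteq> K - interior K \<longrightarrow> closed_segment c d = S)"
    using S unfolding maximal_boundary_segments_def fr by (rule CollectD)
  then obtain a b where ab: "a \<noteq> b" "S = closed_segment a b" "S \<subseteq> K - interior K"
    and max: "\<forall>c d. S \<subseteq> closed_segment c d \<and> closed_segment c d \<subseteq> K - interior K \<longrightarrow> closed_segment c d = S"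
    by (elim exE conjE)
  define m where "m = midpoint a b"
  have "m \<in> S" using ab by (simp add: m_def)
  then have m: "m \<in> K" "m \<notin> rel_interior K"
    using ab rel_interior_nonempty_interior[OF K(3)] by auto
  obtain n where n: "n \<noteq> 0" "\<And>y. y \<in> K \<Longrightarrow> n \<bullet> m \<le> n \<bullet> y"
    using supporting_hyperplane_rel_boundary[OF K(2) m] by metis
  define v where "v = - n"
  have v: "v \<noteq> 0" "\<And>y. y \<in> K \<Longrightarrow> v \<bullet> y \<le> v \<bullet> m" using n by (auto simp: v_def)
  have abK: "a \<in> K" "b \<in> K" using ab by auto
  have "2 * (v \<bullet> m) = v \<bullet> a + v \<bullet> b" by (simp add: m_def midpoint_def inner_add_right)
  then have vab: "v \<bullet> a = v \<bullet> m" "v \<bullet> b = v \<bullet> m" using v(2)[OF abK(1)] v(2)[OF abK(2)] by auto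
  have strict: "v \<bullet> z < v \<bullet> a" if z: "z \<in> interior K" for z
  proof -
    \<comment> \<open>From an interior point one can still move a distance e in direction v, which
      raises the functional.\<close>
    obtain e where e: "e > 0" "cball z e \<subseteq> K" using z by (meson mem_interior_cball)
    have "z + (e / norm v) *\<^sub>R v \<in> cball z e" using e v(1) by (simp add: dist_norm)
    then have "v \<bullet> (z + (e / norm v) *\<^sub>R v) \<le> v \<bullet> m" using e v(2) by blast
    moreover have "0 < (e / norm v) * (v \<bullet> v)" using e v(1) by simp
    ultimately show ?thesis using vab by (simp add: inner_add_right)
  qed
  define F where "F = {z \<in> K. v \<bullet> z = v \<bullet> a}"
  have F_eq: "F = K \<inter> {z. v \<bullet> z = v \<bullet> a}" by (auto simp: F_def)
  have "compact F" "convex F" unfolding F_eq using K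
    by (auto intro!: compact_Int_closed closed_hyperplane convex_Int convex_hyperplane)
  moreover have "collinear F"
    unfolding collinear_def
  proof (rule exI[of _ "\<i> * v"], intro ballI)
    fix x y assume "x \<in> F" "y \<in> F"
    then have o: "Re v * Re (x - y) + Im v * Im (x - y) = 0"
      by (simp add: F_def inner_complex_def algebra_simps)
    have vv: "(Re v)\<^sup>2 + (Im v)\<^sup>2 \<noteq> 0" using v(1) by (simp add: complex_eq_iff)
    \<comment> \<open>The coordinate of x - y along \<open>\<i> * v\<close>, the direction of the
      supporting line.\<close>
    define c where "c = (Im (x - y) * Re v - Re (x - y) * Im v) / ((Re v)\<^sup>2 + (Im v)\<^sup>2)"
    have c: "c * ((Re v)\<^sup>2 + (Im v)\<^sup>2) = Im (x - y) * Re v - Re (x - y) * Im v" using vv by (simp add: c_def)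
    have "((Re v)\<^sup>2 + (Im v)\<^sup>2) * Re (x - y) = ((Re v)\<^sup>2 + (Im v)\<^sup>2) * (- c * Im v)"
      "((Re v)\<^sup>2 + (Im v)\<^sup>2) * Im (x - y) = ((Re v)\<^sup>2 + (Im v)\<^sup>2) * (c * Re v)"
      using c o by algebra+
    then have "Re (x - y) = - c * Im v" "Im (x - y) = c * Re v" using vv by (metis mult_left_cancel)+
    then show "\<exists>c. x - y = c *\<^sub>R (\<i> * v)" by (intro exI[of _ c]) (simp add: complex_eq_iff)
  qed
  moreover have "F \<noteq> {}" using abK by (auto simp: F_def)
  ultimately obtain c d where cd: "F = closed_segment c d" using compact_convex_collinear_segment by blast
  have "closed_segment a b \<subseteq> F"
    unfolding F_eq using abK K(2) vab by (intro closed_segment_subset convex_Int convex_hyperplane) auto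
  moreover have "F \<subseteq> K - interior K" using strict by (force simp: F_def)
  ultimately have "F = S" using max[rule_format, of c d] cd ab by auto
  then show thesis using that[of v a b] v abK vab ab strict unfolding F_def by auto
qed

text \<open>Each normal direction yields a flat and its antipode within one turn, which puts \<phi>
  and \<psi> into the first half turn. Independence of v and w excludes differences 0 and pi, so up
  to exchanging the two pairs the four flats are interlaced as required.\<close>

lemma crossing_flats_not_minimal:
  assumes \<mu>: "\<mu> > 0" and C: "classC_rep \<Omega> L \<theta> k" and \<Omega>: "\<Omega> = interior (convex hull (boundary_curve x0 \<theta> ` {0..L}))"
    and v: "v \<noteq> 0" and w: "w \<noteq> 0" and indep: "\<And>t. w \<noteq> t *\<^sub>R v"
    and faces: "\<And>n. n \<in> {v, -v, w, -w} \<Longrightarrow> \<exists>x y. x \<noteq> y \<and>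
       x \<in> convex hull (boundary_curve x0 \<theta> ` {0..L}) \<and> y \<in> convex hull (boundary_curve x0 \<theta> ` {0..L}) \<and>
       (\<forall>z\<in>convex hull (boundary_curve x0 \<theta> ` {0..L}). n \<bullet> z \<le> n \<bullet> x \<and> n \<bullet> z \<le> n \<bullet> y)"
  obtains \<Omega>' \<theta>' k' where "classC_rep \<Omega>' L \<theta>' k'" "J_fun \<mu> \<Omega>' L k' < J_fun \<mu> \<Omega> L k"
proof -
  obtain k0 where k0: "angle_rep L \<theta> k0" "L > 0" "(LINT t:{0..L}|lborel. cis (\<theta> t)) = 0"
    by (rule classC_rep_angle_rep'[OF C])
  interpret convex_closed_curve L \<theta> "boundary_curve x0 \<theta>"
    by (rule angle_rep_convex_closed_curve[OF k0])
  let ?K = "convex hull (boundary_curve x0 \<theta> ` {0..L})"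
  have flats: "\<exists>a b a' b' \<phi> r. 0 \<le> a \<and> a < b \<and> b \<le> L \<and> (\<forall>t\<in>{a..b}. \<theta> t = \<phi>) \<and>
    0 \<le> a' \<and> a' < b' \<and> b' \<le> L \<and> (\<forall>t\<in>{a'..b'}. \<theta> t = \<phi> + pi) \<and> r *\<^sub>R (\<i> * cis \<phi>) = n" if n: "n \<in> {v, w}" for n
  proof -
    have n0: "n \<noteq> 0" using n v w by auto
    have "n \<in> {v, -v, w, -w}" "-n \<in> {v, -v, w, -w}" using n by auto
    note n12 = this
    from faces[OF n12(1)] obtain x y where x: "x \<noteq> y" "x \<in> ?K" "y \<in> ?K"
      and xm: "\<forall>z\<in>?K. n \<bullet> z \<le> n \<bullet> x \<and> n \<bullet> z \<le> n \<bullet> y" by (elim exE conjE)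
    from faces[OF n12(2)] obtain x' y' where x': "x' \<noteq> y'" "x' \<in> ?K" "y' \<in> ?K"
      and xm': "\<forall>z\<in>?K. -n \<bullet> z \<le> -n \<bullet> x' \<and> -n \<bullet> z \<le> -n \<bullet> y'" by (elim exE conjE)
    note m = xm[THEN bspec, THEN conjunct1] xm[THEN bspec, THEN conjunct2]
    note m' = xm'[THEN bspec, THEN conjunct1] xm'[THEN bspec, THEN conjunct2]
    show ?thesis
      by (rule antipodal_flat_intervals[OF n0 x(2,3,1) m x'(2,3,1) m']) blast+
  qed
  have "v \<in> {v, w}" "w \<in> {v, w}" by auto
  from flats[OF this(1)] obtain a1 b1 a3 b3 \<phi> r where 1: "0 \<le> a1" "a1 < b1" "b1 \<le> L" "\<forall>t\<in>{a1..b1}. \<theta> t = \<phi>"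
    and 3: "0 \<le> a3" "a3 < b3" "b3 \<le> L" "\<forall>t\<in>{a3..b3}. \<theta> t = \<phi> + pi" and r: "r *\<^sub>R (\<i> * cis \<phi>) = v"
    by (elim exE conjE)
  from flats[OF \<open>w \<in> {v, w}\<close>] obtain a2 b2 a4 b4 \<psi> q where 2: "0 \<le> a2" "a2 < b2" "b2 \<le> L" "\<forall>t\<in>{a2..b2}. \<theta> t = \<psi>"
    and 4: "0 \<le> a4" "a4 < b4" "b4 \<le> L" "\<forall>t\<in>{a4..b4}. \<theta> t = \<psi> + pi" and q: "q *\<^sub>R (\<i> * cis \<psi>) = w"
    by (elim exE conjE)
  have r0: "r \<noteq> 0" using r v by auto
  have par: "False" if "cis \<psi> = s *\<^sub>R cis \<phi>" for s
  proof -
    have "w = (q * s / r) *\<^sub>R v"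
      unfolding r[symmetric] q[symmetric] that using r0 by (simp add: mult.commute)
    then show False using indep by blast
  qed
  have "\<theta> a1 = \<phi>" "\<theta> a2 = \<psi>" "\<theta> a3 = \<phi> + pi" "\<theta> a4 = \<psi> + pi" using 1 2 3 4 by auto
  then have rng: "\<theta> 0 \<le> \<phi>" "\<theta> 0 \<le> \<psi>" "\<phi> + pi \<le> \<theta> 0 + 2 * pi" "\<psi> + pi \<le> \<theta> 0 + 2 * pi"
    using angle_mono[of 0 a1] angle_mono[of 0 a2] angle_mono[of a3 L] angle_mono[of a4 L] 1(1-3) 2(1-3) 3(1-3) 4(1-3) angle_total by auto
  have "\<psi> \<noteq> \<phi>" using par[of 1] by auto
  moreover have "\<psi> \<noteq> \<phi> + pi" using par[of "-1"] by (auto simp: cis_mult[symmetric])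
  moreover have "\<phi> \<noteq> \<psi> + pi"
    using par[of "-1"] by (auto simp: cis_mult[symmetric])
  ultimately consider "\<phi> < \<psi>" "\<psi> < \<phi> + pi" | "\<psi> < \<phi>" "\<phi> < \<psi> + pi" using rng by argo
  then show thesis
  proof cases
    case lt: 1
    show thesis
      by (rule four_flat_intervals_not_minimal[OF \<mu> C \<Omega> 1(1-3) _ 2(1-3) _ 3(1-3) _ 4(1-3) _ lt])
         (use 1(4) 2(4) 3(4) 4(4) that in blast)+
  next
    case lt: 2
    show thesis
      by (rule four_flat_intervals_not_minimal[OF \<mu> C \<Omega> 2(1-3) _ 1(1-3) _ 4(1-3) _ 3(1-3) _ lt])
         (use 1(4) 2(4) 3(4) 4(4) that in blast)+
  qed
qed

section \<open>Point reflections and maximal boundary segments\<close>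

lemma point_reflection_segment:
  fixes c :: complex
  shows "(\<lambda>x. 2 * c - x) ` closed_segment a b = closed_segment (2 * c - a) (2 * c - b)"
proof -
  have "(\<lambda>x. 2 * c - x) ` closed_segment a b = (+) (2 * c) ` uminus ` closed_segment a b"
    by (auto simp: image_image)
  also have "uminus ` closed_segment a b = closed_segment (-a) (-b)"
    by (rule closed_segment_linear_image[symmetric]) (simp add: linear_uminus)
  finally show ?thesis using closed_segment_translation[of "2 * c" "- a" "- b"] by simp
qed

text \<open>The reflection is an affine involution preserving \<Omega>, hence its closure and
  frontier. A segment extending the image of S is reflected back to one extending S.\<close>

lemma point_reflection_maximal_segment:
  assumes sym: "\<And>x. x \<in> \<Omega> \<longleftrightarrow> 2 * c - x \<in> \<Omega>" and S: "S \<in> maximal_boundary_segments \<Omega>"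
  shows "(\<lambda>x. 2 * c - x) ` closure \<Omega> = closure \<Omega>" "(\<lambda>x. 2 * c - x) ` S \<in> maximal_boundary_segments \<Omega>"
proof -
  let ?R = "\<lambda>x. 2 * c - x"
  have inv: "?R ` ?R ` A = A" for A by (simp add: image_image)
  have image: "?R ` A = {x. ?R x \<in> A}" for A
    by (force simp: image_iff)
  have "?R ` closure A = closure (?R ` A)" for A
  proof -
    have "?R ` A = (+) (2 * c) ` uminus ` A" for A by (auto simp: image_image)
    then show ?thesis 
      by (simp only: closure_translation closure_injective_linear_image[OF linear_uminus inj_uminus])
  qed
  moreover have R: "?R ` \<Omega> = \<Omega>" unfolding image using sym by blast
  ultimately show cl: "?R ` closure \<Omega> = closure \<Omega>" by simp
  have "?R ` interior A = interior (?R ` A)" for A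
  proof -
    have "?R ` A = (+) (2 * c) ` uminus ` A" for A by (auto simp: image_image)
    then show ?thesis 
      by (simp only: interior_translation interior_injective_linear_image[OF linear_uminus inj_uminus])
  qed
  then have "?R ` interior \<Omega> = interior \<Omega>" by (simp add: R)
  moreover have "inj ?R" by (auto simp: inj_def)
  ultimately have fr: "?R ` frontier \<Omega> = frontier \<Omega>" using cl by (simp add: frontier_def image_set_diff)
  have "\<exists>a b. a \<noteq> b \<and> S = closed_segment a b \<and> S \<subseteq> frontier \<Omega> \<and>
      (\<forall>c d. S \<subseteq> closed_segment c d \<and> closed_segment c d \<subseteq> frontier \<Omega> \<longrightarrow> closed_segment c d = S)"
    using S unfolding maximal_boundary_segments_def by (rule CollectD)
  then obtain a b where ab: "a \<noteq> b" "S = closed_segment a b" "S \<subseteq> frontier \<Omega>"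
    and max: "\<forall>c d. S \<subseteq> closed_segment c d \<and> closed_segment c d \<subseteq> frontier \<Omega> \<longrightarrow> closed_segment c d = S"
    by (elim exE conjE)
  show "?R ` S \<in> maximal_boundary_segments \<Omega>"
    unfolding maximal_boundary_segments_def
  proof (rule CollectI, intro exI conjI allI impI)
    show "2 * c - a \<noteq> 2 * c - b" using ab by simp
    show "?R ` S = closed_segment (2 * c - a) (2 * c - b)" unfolding ab(2) by (rule point_reflection_segment)
    show "?R ` S \<subseteq> frontier \<Omega>" using image_mono[OF ab(3), of ?R] fr by simp
    fix x y assume xy: "?R ` S \<subseteq> closed_segment x y \<and> closed_segment x y \<subseteq> frontier \<Omega>"
    have "S \<subseteq> closed_segment (?R x) (?R y)" "closed_segment (?R x) (?R y) \<subseteq> frontier \<Omega>"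
      using xy image_mono[of "?R ` S" "closed_segment x y" ?R] image_mono[of "closed_segment x y" "frontier \<Omega>" ?R]
      unfolding inv fr point_reflection_segment by auto
    then have "closed_segment (?R x) (?R y) = S" using max by blast
    then have "?R ` closed_segment x y = S" by (simp only: point_reflection_segment)
    then show "closed_segment x y = ?R ` S" using inv by metis
  qed
qed

lemma maximal_boundary_segments_subset:
  assumes "S \<in> maximal_boundary_segments \<Omega>" "T \<in> maximal_boundary_segments \<Omega>" "S \<subseteq> T"
  shows "T = S"
proof -
  obtain a b where "T = closed_segment a b" "T \<subseteq> frontier \<Omega>"
    using assms(2) unfolding maximal_boundary_segments_def by blast
  then show ?thesis using assms(1,3) unfolding maximal_boundary_segments_def by blast
qed

theorem mainTheorem9:
  fixes \<mu> :: real and \<Omega> :: "complex set"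
  assumes "\<mu> > 0"
    and "optimal_domain \<mu> \<Omega>"
    and "centrally_symmetric \<Omega>"
  shows "maximal_boundary_segments \<Omega> = {} \<or> card (maximal_boundary_segments \<Omega>) = 2"
proof (cases "maximal_boundary_segments \<Omega> = {}")
  case False
  then obtain S where S: "S \<in> maximal_boundary_segments \<Omega>" by blast
  obtain \<theta> k where C: "classC_rep \<Omega> (2 * pi) \<theta> k"
    and min: "\<And>\<Omega>' \<theta>' k'. classC_rep \<Omega>' (2 * pi) \<theta>' k' \<Longrightarrow> J_fun \<mu> \<Omega> (2 * pi) k \<le> J_fun \<mu> \<Omega>' (2 * pi) k'"
    using assms(2) unfolding optimal_domain_def by blast
  obtain x0 where \<Omega>: "\<Omega> = interior (convex hull (boundary_curve x0 \<theta> ` {0..2 * pi}))"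
    using C unfolding classC_rep_def by blast
  obtain c where sym: "\<And>x. x \<in> \<Omega> \<longleftrightarrow> 2 * c - x \<in> \<Omega>" using assms(3) unfolding centrally_symmetric_def by blast
  let ?R = "\<lambda>x. 2 * c - x"
  define K where "K = convex hull (boundary_curve x0 \<theta> ` {0..2 * pi})"
  obtain k0 where k0: "angle_rep (2 * pi) \<theta> k0" "2 * pi > 0" "(LINT t:{0..2 * pi}|lborel. cis (\<theta> t)) = 0"
    by (rule classC_rep_angle_rep'[OF C])
  have K: "compact K" "convex K"
    using convex_closed_curve.compact_curve[OF angle_rep_convex_closed_curve[OF k0]]
    by (auto simp: K_def intro: compact_convex_hull)
  have \<Omega>K: "\<Omega> = interior K" by (simp add: \<Omega> K_def)
  have "\<Omega> \<noteq> {}" using S by (auto simp: maximal_boundary_segments_def)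
  then have K_int: "interior K \<noteq> {}" by (simp add: \<Omega>K)
  have "closure \<Omega> = K"
    unfolding \<Omega>K using convex_closure_interior[OF K(2) K_int] K(1) by (simp add: compact_imp_closed)
  then have RK: "?R x \<in> K" if "x \<in> K" for x
    using point_reflection_maximal_segment(1)[OF sym S] that by blast
  note normal = boundary_segment_normal[OF K K_int, folded \<Omega>K]
  obtain v a b where v: "v \<noteq> 0" "a \<noteq> b" "a \<in> K" "b \<in> K" "\<forall>z\<in>K. v \<bullet> z \<le> v \<bullet> a" "v \<bullet> b = v \<bullet> a"
    "\<forall>z\<in>\<Omega>. v \<bullet> z < v \<bullet> a" "S = {z \<in> K. v \<bullet> z = v \<bullet> a}"
    by (rule normal[OF S])
  have vmin: "v \<bullet> ?R a \<le> v \<bullet> z" if "z \<in> K" for z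
    using v(5)[rule_format, OF RK[OF that]] by (simp add: inner_diff_right)
  have RS: "?R ` S \<in> maximal_boundary_segments \<Omega>"
    by (rule point_reflection_maximal_segment(2)[OF sym S])
  \<comment> \<open>The reflected segment lies on the line where v is minimal on K; equality would
    make v constant on K, against strictness on \<Omega>.\<close>
  have "S \<noteq> ?R ` S"
  proof
    assume "S = ?R ` S"
    moreover have "a \<in> S" using v by simp
    ultimately have "?R a \<in> S" by blast
    then have e: "v \<bullet> ?R a = v \<bullet> a" using v(8) by simp
    obtain z where z: "z \<in> \<Omega>" using \<open>\<Omega> \<noteq> {}\<close> by blast
    then have "z \<in> K" using \<Omega>K interior_subset by blast
    then show False using vmin[of z] v(7)[rule_format, OF z] e by simp
  qed
  moreover have "T = S \<or> T = ?R ` S" if T: "T \<in> maximal_boundary_segments \<Omega>" for T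
  proof -
    obtain w a' b' where w: "w \<noteq> 0" "a' \<noteq> b'" "a' \<in> K" "b' \<in> K" "\<forall>z\<in>K. w \<bullet> z \<le> w \<bullet> a'" "w \<bullet> b' = w \<bullet> a'"
      "\<forall>z\<in>\<Omega>. w \<bullet> z < w \<bullet> a'" "T = {z \<in> K. w \<bullet> z = w \<bullet> a'}"
      by (rule normal[OF T])
    have TI: "z \<in> T" if "z \<in> K" "w \<bullet> a' \<le> w \<bullet> z" for z
      using w(5)[rule_format, OF that(1)] w(8) that by auto
    show ?thesis
    \<comment> \<open>Parallel normals give the face S or its reflection according to the sign of t;
      independent normals give two crossing pairs of sides and contradict optimality.\<close>
    proof (cases "\<exists>t. w = t *\<^sub>R v")
      case True
      then obtain t where t: "w = t *\<^sub>R v" by blast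
      then consider "t > 0" | "t < 0" using w(1) by fastforce
      then show ?thesis
      proof cases
        case 1
        have "S \<subseteq> T"
        proof
          fix z assume "z \<in> S"
          then have "z \<in> K" "v \<bullet> z = v \<bullet> a" using v(8) by auto
          then show "z \<in> T" using v(5)[rule_format, OF w(3)] 1 by (intro TI) (auto simp: t)
        qed
        then show ?thesis using maximal_boundary_segments_subset[OF S T] by simp
      next
        case 2
        have "?R ` S \<subseteq> T"
        proof
          fix z assume "z \<in> ?R ` S"
          then have "z \<in> K" "v \<bullet> z = v \<bullet> ?R a" using v(8) RK by (auto simp: inner_diff_right)
          then show "z \<in> T" using vmin[OF w(3)] 2 by (intro TI) (auto simp: t mult_le_cancel_left)
        qed
        then show ?thesis using maximal_boundary_segments_subset[OF RS T] by simp
      qed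
    next
      case False
      have face: "\<exists>x y. x \<noteq> y \<and> x \<in> K \<and> y \<in> K \<and> (\<forall>z\<in>K. n \<bullet> z \<le> n \<bullet> x \<and> n \<bullet> z \<le> n \<bullet> y)"
        if "a \<noteq> b" "a \<in> K" "b \<in> K" "\<forall>z\<in>K. u \<bullet> z \<le> u \<bullet> a" "u \<bullet> b = u \<bullet> a" "n = u \<or> n = - u" for a b u n
      proof (cases "n = u")
        case True
        then show ?thesis using that by (intro exI[of _ a] exI[of _ b]) auto
      next
        case n: False
        \<comment> \<open>Central symmetry turns the face with outer normal u into one with outer
          normal \<open>- u\<close>.\<close>
        have "- u \<bullet> z \<le> - u \<bullet> ?R a" if "z \<in> K" for z
          using \<open>\<forall>z\<in>K. u \<bullet> z \<le> u \<bullet> a\<close>[rule_format, OF RK[OF that]] by (simp add: inner_diff_right)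
        then show ?thesis using that n RK by (intro exI[of _ "?R a"] exI[of _ "?R b"]) (auto simp: inner_diff_right)
      qed
      have faces: "\<exists>x y. x \<noteq> y \<and> x \<in> K \<and> y \<in> K \<and> (\<forall>z\<in>K. n \<bullet> z \<le> n \<bullet> x \<and> n \<bullet> z \<le> n \<bullet> y)"
        if n: "n \<in> {v, -v, w, -w}" for n
      proof -
        have "n = v \<or> n = -v \<or> n = w \<or> n = -w" using n by simp
        then show ?thesis using face[OF v(2-6), of n] face[OF w(2-6), of n] by blast
      qed
      have indep: "\<And>t. w \<noteq> t *\<^sub>R v" using False by blast
      obtain \<Omega>' \<theta>' k' where "classC_rep \<Omega>' (2 * pi) \<theta>' k'" "J_fun \<mu> \<Omega>' (2 * pi) k' < J_fun \<mu> \<Omega> (2 * pi) k"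
        by (rule crossing_flats_not_minimal[OF assms(1) C \<Omega> v(1) w(1) indep faces[unfolded K_def]])
      then show ?thesis using min by (meson not_le)
    qed
  qed
  ultimately have "maximal_boundary_segments \<Omega> = {S, ?R ` S}" using S RS by blast
  then show ?thesis using \<open>S \<noteq> ?R ` S\<close> by simp
qed simp

end
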